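(* Let $k$ be an algebraically closed field of characteristic $0$, $C$ a nonsingular curve over $k$, and $K=k(C)$ its function field. Let $\varphi:\mathbb{P}^1_K\to\mathbb{P}^1_K$ be a morphism of degree two, and let $\Phi$ be a presentation of $\varphi$. Let $p\in C$ be a closed point. If the reduction of $\Phi$ at $p$ is semi-stable, then $(R_\varphi)_p=(R_\Phi)_p$.
   Context: For a closed point $p\in C$, $v_p$ is the normalized valuation of the discrete valuation ring $\mathcal{O}_{C,p}$ and $\kappa(p)=k$ the residue field. Presentations: fix coordinates $[X,Y]$ on $\mathbb{P}^1_K$. A presentation of a degree $d$ morphism $\varphi$ is the point $\Phi=[\mathbf{a},\mathbf{b}]=[a_0,\dots,a_d,b_0,\dots,b_d]\in\mathbb{P}^{2d+1}(K)$ of coefficients of homogeneous forms $F_{\mathbf a}=\sum a_iX^{d-i}Y^i$, $F_{\mathbf b}=\sum b_iX^{d-i}Y^i$ without common zero in $\mathbb{P}^1(\bar K)$ with $\varphi=[F_{\mathbf a}:F_{\mathbf b}]$. A model of $\Phi$ is an affine representative $(\mathbf a,\mathbf b)\in K^{2d+2}$. $\rho(\mathbf a,\mathbf b)$ denotes the resultant of $F_{\mathbf a},F_{\mathbf b}$ as forms of degree $d$ (the $2d\times 2d$ Sylvester determinant). Action: for $\Gamma=\begin{pmatrix}\alpha&\beta\\ \gamma&\delta\end{pmatrix}\in\mathrm{GL}_2(K)$, $(\mathbf a^\Gamma,\mathbf b^\Gamma)$ are the coefficients of $\Gamma^{\mathrm{adj}}\cdot\big(F_{\mathbf a}(\alpha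 X+\beta Y,\gamma X+\delta Y),\,F_{\mathbf b}(\alpha X+\beta Y,\gamma X+\delta Y)\big)^T$, with $\Gamma^{\mathrm{adj}}=\begin{pmatrix}\delta&-\beta\\-\gamma&\alpha\end{pmatrix}$; this induces the conjugation action $\Phi\mapsto\Phi^\Gamma$ of $\mathrm{PGL}_2(K)$. Resultant divisors: $n_p(\mathbf a,\mathbf b)$ is the minimum of $v_p$ over all coordinates, $N_{\Phi,p}=v_p(\rho(\mathbf a,\mathbf b))-2d\,n_p(\mathbf a,\mathbf b)$ (independent of the model). $R_\Phi=\sum_pN_{\Phi,p}[p]$ is the resultant divisor of the presentation, and $R_\varphi=\sum_p\min_{\Gamma\in \mathrm{PGL}_2(K)}N_{\Phi^\Gamma,p}\,[p]$ is the minimal resultant of $\varphi$; $(D)_p$ denotes the coefficient of a divisor $D$ at $p$. Reduction: scaling a model so that $n_p=0$ and reducing the coordinates modulo $p$ gives the reduction $\Phi_p\in\mathbb{P}^{2d+1}(k)$. A point of $\mathbb{P}^{2d+1}(k)$ is unstable if it is $\mathrm{SL}_2(k)$-conjugate to a point with $a_i=0$ for all $i\le\frac{d-1}{2}$ and $b_j=0$ for all $j\le\frac{d+1}{2}$; otherwise it is semi-stable (this is GIT semi-stability for the conjugation action). *)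

theory Defs
  imports
    "HOL-Algebra.Algebraic_Closure_Type"
    "Jordan_Normal_Form.Determinant"
    "Subresultants.Resultant_Prelim"
begin

section \<open>Nonsingular curves and their function fields\<close>

text \<open>
  A nonsingular curve over an algebraically closed field $k$ is encoded as an abstract
  nonsingular curve (Hartshorne, Section I.6): a cofinite set of discrete valuation rings of a
  function field $K$ of one variable over $k$.  The inclusion of $k$ in $K$ is a field
  homomorphism \<open>\<iota>\<close>; a closed point is represented by the normalized valuation of its local ring.
\<close>

definition adjoined_field :: "('k::field \<Rightarrow> 'K::field) \<Rightarrow> 'K \<Rightarrow> 'K set" where
  "adjoined_field \<iota> t =
     {poly (map_poly \<iota> f) t / poly (map_poly \<iota> g) t | f g. g \<noteq> 0}"

definition function_field :: "('k::field \<Rightarrow> 'K::field) \<Rightarrow> bool" where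
  "function_field \<iota> \<longleftrightarrow> field_hom \<iota> \<and>
     (\<exists>t. (\<forall>f. poly (map_poly \<iota> f) t = 0 \<longrightarrow> f = 0) \<and>
          (\<exists>B. finite B \<and>
            (\<forall>x. \<exists>c. (\<forall>b\<in>B. c b \<in> adjoined_field \<iota> t) \<and> x = (\<Sum>b\<in>B. c b * b))))"

text \<open>
  The value at $0$ ought to be infinite; the convention \<open>v 0 = 0\<close> only serves to make the
  correspondence between valuation rings and these functions bijective, and every use of a value
  below is guarded accordingly.
\<close>

definition normalized_valuation :: "('k::field \<Rightarrow> 'K::field) \<Rightarrow> ('K \<Rightarrow> int) \<Rightarrow> bool" where
  "normalized_valuation \<iota> v \<longleftrightarrow>
     v 0 = 0 \<and>
     (\<forall>x y. x \<noteq> 0 \<longrightarrow> y \<noteq> 0 \<longrightarrow> v (x * y) = v x + v y) \<and>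
     (\<forall>x y. x \<noteq> 0 \<longrightarrow> y \<noteq> 0 \<longrightarrow> x + y \<noteq> 0 \<longrightarrow> min (v x) (v y) \<le> v (x + y)) \<and>
     (\<forall>c. c \<noteq> 0 \<longrightarrow> v (\<iota> c) = 0) \<and>
     (\<exists>x. x \<noteq> 0 \<and> v x = 1)"

definition nonsingular_curve ::
    "('k::alg_closed_field \<Rightarrow> 'K::field) \<Rightarrow> ('K \<Rightarrow> int) set \<Rightarrow> bool" where
  "nonsingular_curve \<iota> C \<longleftrightarrow> function_field \<iota> \<and>
     C \<subseteq> Collect (normalized_valuation \<iota>) \<and> finite (Collect (normalized_valuation \<iota>) - C)"

definition maximal_ideal_at :: "('K::field \<Rightarrow> int) \<Rightarrow> 'K set" where
  "maximal_ideal_at v = {x. x = 0 \<or> 0 < v x}"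

text \<open>
  The residue class of an element of the local ring, under the identification of the residue
  field with $k$ (valid as $k$ is algebraically closed); meaningful only for \<open>x = 0 \<or> v x \<ge> 0\<close>.
\<close>

definition residue_at :: "('k::field \<Rightarrow> 'K::field) \<Rightarrow> ('K \<Rightarrow> int) \<Rightarrow> 'K \<Rightarrow> 'k" where
  "residue_at \<iota> v x = (THE c. x - \<iota> c \<in> maximal_ideal_at v)"


section \<open>Projective space\<close>

text \<open>Points are the classes themselves, so the elements of a point are its affine representatives.\<close>

definition proj_rel :: "('a::field vec \<times> 'a vec) set" where
  "proj_rel = {(u, w). \<exists>c. c \<noteq> 0 \<and> w = c \<cdot>\<^sub>v u}"

definition proj_space :: "nat \<Rightarrow> 'a::field vec set set" where
  "proj_space n = (carrier_vec (n + 1) - {0\<^sub>v (n + 1)}) // proj_rel"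

definition proj_line_pt :: "'a::field \<Rightarrow> 'a \<Rightarrow> 'a vec set" where
  "proj_line_pt x y = proj_rel `` {vec_of_list [x, y]}"


section \<open>Models and presentations\<close>

text \<open>
  A model is a vector $(a_0, \dots, a_d, b_0, \dots, b_d)$ of dimension $2d+2$.  The forms
  $F_a$, $F_b$ are evaluated in an arbitrary extension ring of the coefficient ring, embedded by
  \<open>e\<close>: the algebraic closure or a polynomial ring.
\<close>

definition coeffs_a :: "nat \<Rightarrow> 'a vec \<Rightarrow> 'a vec" where
  "coeffs_a d w = vec_first w (d + 1)"

definition coeffs_b :: "nat \<Rightarrow> 'a vec \<Rightarrow> 'a vec" where
  "coeffs_b d w = vec_last w (d + 1)"

definition form_eval :: "('a \<Rightarrow> 'b::comm_ring_1) \<Rightarrow> nat \<Rightarrow> 'a vec \<Rightarrow> 'b \<Rightarrow> 'b \<Rightarrow> 'b" where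
  "form_eval e d u x y = (\<Sum>i\<le>d. e (u $ i) * x ^ (d - i) * y ^ i)"

definition no_common_zero :: "nat \<Rightarrow> 'K::field vec \<Rightarrow> bool" where
  "no_common_zero d w \<longleftrightarrow>
     (\<forall>x y. (x, y) \<noteq> (0, 0) \<longrightarrow>
        \<not> (form_eval to_ac d (coeffs_a d w) x y = 0 \<and> form_eval to_ac d (coeffs_b d w) x y = 0))"

text \<open>
  A morphism of the projective line over $K$ is represented by its effect on geometric points,
  which determines it; its values outside \<open>proj_space 1\<close> are irrelevant.
\<close>

definition is_presentation ::
    "nat \<Rightarrow> ('K::field alg_closure vec set \<Rightarrow> 'K alg_closure vec set) \<Rightarrow> 'K vec set \<Rightarrow> bool" where
  "is_presentation d \<phi> \<Phi> \<longleftrightarrow> \<Phi> \<in> proj_space (2 * d + 1) \<and>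
     (\<forall>w\<in>\<Phi>. no_common_zero d w \<and>
        (\<forall>x y. (x, y) \<noteq> (0, 0) \<longrightarrow>
           \<phi> (proj_line_pt x y) =
             proj_line_pt (form_eval to_ac d (coeffs_a d w) x y)
                          (form_eval to_ac d (coeffs_b d w) x y)))"

definition morphism_of_degree ::
    "nat \<Rightarrow> ('K::field alg_closure vec set \<Rightarrow> 'K alg_closure vec set) \<Rightarrow> bool" where
  "morphism_of_degree d \<phi> \<longleftrightarrow> (\<exists>\<Phi>. is_presentation d \<phi> \<Phi>)"

text \<open>
  The Sylvester matrix of formal size $2d \times 2d$ (the actual degrees of the dehomogenized
  forms may be smaller).
\<close>

definition form_resultant :: "nat \<Rightarrow> 'a::comm_ring_1 vec \<Rightarrow> 'a" where
  "form_resultant d w =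
     det (sylvester_mat_sub d d
       (form_eval (\<lambda>c. [:c:]) d (coeffs_a d w) [:0, 1:] 1)
       (form_eval (\<lambda>c. [:c:]) d (coeffs_b d w) [:0, 1:] 1))"


section \<open>The conjugation action\<close>

definition GL2 :: "'a::field mat set" where
  "GL2 = {G \<in> carrier_mat 2 2. det G \<noteq> 0}"

definition SL2 :: "'a::field mat set" where
  "SL2 = {G \<in> carrier_mat 2 2. det G = 1}"

text \<open>
  The forms are evaluated at $X = 1$, $Y$ the polynomial variable, so the coefficient of degree
  $j$ is the one of $X^{d-j} Y^j$ in the homogeneous form.
\<close>

definition conj_model :: "nat \<Rightarrow> 'a::field mat \<Rightarrow> 'a vec \<Rightarrow> 'a vec" where
  "conj_model d G w =
     (let \<alpha> = G $$ (0, 0); \<beta> = G $$ (0, 1); \<gamma> = G $$ (1, 0); \<delta> = G $$ (1, 1);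
          P = form_eval (\<lambda>c. [:c:]) d (coeffs_a d w) [:\<alpha>, \<beta>:] [:\<gamma>, \<delta>:];
          Q = form_eval (\<lambda>c. [:c:]) d (coeffs_b d w) [:\<alpha>, \<beta>:] [:\<gamma>, \<delta>:]
      in vec (d + 1) (\<lambda>j. coeff (smult \<delta> P - smult \<beta> Q) j) @\<^sub>v
         vec (d + 1) (\<lambda>j. coeff (smult \<alpha> Q - smult \<gamma> P) j))"

text \<open>As \<open>conj_model d G\<close> is linear, the image of a point is a point.\<close>

definition conj_point :: "nat \<Rightarrow> 'a::field mat \<Rightarrow> 'a vec set \<Rightarrow> 'a vec set" where
  "conj_point d G \<Phi> = conj_model d G ` \<Phi>"


section \<open>Resultant divisors\<close>

definition min_valuation :: "('K::field \<Rightarrow> int) \<Rightarrow> 'K vec \<Rightarrow> int" where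
  "min_valuation v w = Min (v ` (set\<^sub>v w - {0}))"

text \<open>
  The numbers $N_{\Phi,p}$, first for a model and then for a point; \<open>the_elem\<close> expresses that the
  choice of the model does not matter.
\<close>

definition model_resultant_order :: "nat \<Rightarrow> ('K::field \<Rightarrow> int) \<Rightarrow> 'K vec \<Rightarrow> int" where
  "model_resultant_order d v w = v (form_resultant d w) - 2 * int d * min_valuation v w"

definition resultant_order :: "nat \<Rightarrow> ('K::field \<Rightarrow> int) \<Rightarrow> 'K vec set \<Rightarrow> int" where
  "resultant_order d v \<Phi> = the_elem (model_resultant_order d v ` \<Phi>)"

text \<open>Divisors on a curve are given by their coefficient functions.\<close>

definition resultant_divisor ::
    "('K::field \<Rightarrow> int) set \<Rightarrow> nat \<Rightarrow> 'K vec set \<Rightarrow> ('K \<Rightarrow> int) \<Rightarrow> int" where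
  "resultant_divisor C d \<Phi> p = (if p \<in> C then resultant_order d p \<Phi> else 0)"

text \<open>
  The minimum over $\mathrm{PGL}_2(K)$ is written over representatives in $\mathrm{GL}_2(K)$:
  scaling \<open>G\<close> does not change the conjugated point.  The presentation of \<open>\<phi>\<close> is unique.
\<close>

definition minimal_resultant ::
    "('K::field \<Rightarrow> int) set \<Rightarrow> nat \<Rightarrow> ('K alg_closure vec set \<Rightarrow> 'K alg_closure vec set) \<Rightarrow>
     ('K \<Rightarrow> int) \<Rightarrow> int" where
  "minimal_resultant C d \<phi> p =
     (if p \<in> C
      then (LEAST n. \<exists>\<Phi> G. is_presentation d \<phi> \<Phi> \<and> G \<in> GL2 \<and>
              n = resultant_order d p (conj_point d G \<Phi>))
      else 0)"


section \<open>Reduction and semi-stability\<close>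

text \<open>
  The models with minimal valuation $0$ differ by units of the local ring, whose residues exhaust
  $k^\times$; hence their reductions form exactly one point over $k$.
\<close>

definition reduction :: "('k::field \<Rightarrow> 'K::field) \<Rightarrow> ('K \<Rightarrow> int) \<Rightarrow> 'K vec set \<Rightarrow> 'k vec set" where
  "reduction \<iota> v \<Phi> = map_vec (residue_at \<iota> v) ` {w \<in> \<Phi>. min_valuation v w = 0}"

definition unstable :: "nat \<Rightarrow> 'k::field vec set \<Rightarrow> bool" where
  "unstable d \<Psi> \<longleftrightarrow>
     (\<exists>G\<in>SL2. \<forall>w\<in>conj_point d G \<Psi>.
        (\<forall>i\<le>d. real i \<le> (real d - 1) / 2 \<longrightarrow> coeffs_a d w $ i = 0) \<and>
        (\<forall>j\<le>d. real j \<le> (real d + 1) / 2 \<longrightarrow> coeffs_b d w $ j = 0))"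

definition semi_stable :: "nat \<Rightarrow> 'k::field vec set \<Rightarrow> bool" where
  "semi_stable d \<Psi> \<longleftrightarrow> \<not> unstable d \<Psi>"

end

(*
  Write a matrix G over K as U D V^-1 with U, V invertible over the local ring at p and
  D = diag(e, f), v e <= v f (Smith normal form).  Conjugation by G multiplies the resultant by
  (det G)^6, so what must be bounded is the minimal value n of the coordinates of the conjugated
  model.  V does not change n.  If n exceeded 3/2 v(det G), then the explicit action of D would force
  the coordinates a_0, b_0, b_1 of the model conjugated by U into the maximal ideal.  The reduction of U,
  scaled to determinant 1, would then exhibit the reduction of the presentation as unstable.
*)
theory Submission
  imports Defs
begin

section \<open>Conjugation and resultant of quadratic models in coordinates\<close>

text \<open>In degree 2 the resultant has degree 4 in the coordinates, so conjugating a normalized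
  model by G changes its order at p by 6 v(det G) - 4 n; hence the threshold 3/2 v(det G).
  Conjugation by diag(e, f) multiplies a_0, b_0, b_1 by \<open>e^2 * f\<close> or
  \<open>e^3\<close>, the other three coordinates by \<open>e * f^2\<close> or \<open>f^3\<close>.
  As v e <= v f, the first two weights have value at most 3/2 v(e f), and the coordinates carrying
  them are exactly those that \<open>unstable\<close> wants to vanish: this is the numerical
  criterion of Hilbert and Mumford. Two facts implicit in the definitions have to be supplied. The
  minimum in \<open>minimal_resultant\<close> runs over all presentations of a map known only by its
  values at geometric points, so presentations must be unique. And \<open>residue_at\<close> is a
  definite description, meaningful once every element of the valuation ring is congruent to a
  constant; with points given merely as valuations, this is extracted from the finiteness of K over
  k(t) by a dimension count.\<close>

definition mat2 :: "'a \<Rightarrow> 'a \<Rightarrow> 'a \<Rightarrow> 'a \<Rightarrow> 'a::field mat" where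
  "mat2 \<alpha> \<beta> \<gamma> \<delta> =
     mat 2 2 (\<lambda>(i, j). if i = 0 then if j = 0 then \<alpha> else \<beta> else if j = 0 then \<gamma> else \<delta>)"

definition model2 :: "'a \<Rightarrow> 'a \<Rightarrow> 'a \<Rightarrow> 'a \<Rightarrow> 'a \<Rightarrow> 'a \<Rightarrow> 'a vec" where
  "model2 a0 a1 a2 b0 b1 b2 = vec 6 (\<lambda>i. [a0, a1, a2, b0, b1, b2] ! i)"

lemma mat2_carrier [simp]: "mat2 \<alpha> \<beta> \<gamma> \<delta> \<in> carrier_mat 2 2"
  by (simp add: mat2_def)

lemma mat2_entries [simp]:
  "mat2 \<alpha> \<beta> \<gamma> \<delta> $$ (0, 0) = \<alpha>" "mat2 \<alpha> \<beta> \<gamma> \<delta> $$ (0, Suc 0) = \<beta>"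
  "mat2 \<alpha> \<beta> \<gamma> \<delta> $$ (Suc 0, 0) = \<gamma>" "mat2 \<alpha> \<beta> \<gamma> \<delta> $$ (Suc 0, Suc 0) = \<delta>"
  by (simp_all add: mat2_def)

lemma mat2_eta:
  assumes "G \<in> carrier_mat 2 2"
  obtains \<alpha> \<beta> \<gamma> \<delta> where "G = mat2 \<alpha> \<beta> \<gamma> \<delta>"
proof
  show "G = mat2 (G $$ (0, 0)) (G $$ (0, 1)) (G $$ (1, 0)) (G $$ (1, 1))"
    using assms by (intro eq_matI) (auto simp: mat2_def less_2_cases_iff)
qed

text \<open>Laplace expansion along the first row, phrased for explicit \<open>mat\<close> terms so
  that rewriting unfolds a determinant of concrete size into a polynomial.\<close>

lemma det_mat_Suc:
  "det (mat (Suc n) (Suc n) f) =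
     (\<Sum>j<Suc n. f (0, j) * ((-1) ^ j * det (mat n n (\<lambda>(i, k). f (Suc i, if k < j then k else Suc k)))))"
proof -
  have "mat_delete (mat (Suc n) (Suc n) f) 0 j =
      mat n n (\<lambda>(i, k). f (Suc i, if k < j then k else Suc k))" for j
    by (intro eq_matI) (auto simp: mat_delete_def)
  then show ?thesis
    by (subst laplace_expansion_row[of _ "Suc n" 0]) (auto simp: cofactor_def)
qed

lemma det_mat2: "det (mat2 \<alpha> \<beta> \<gamma> \<delta>) = \<alpha> * \<delta> - \<beta> * \<gamma>"
  by (simp add: mat2_def numeral_2_eq_2 det_mat_Suc)

lemma mat2_mult:
  "mat2 \<alpha> \<beta> \<gamma> \<delta> * mat2 \<alpha>' \<beta>' \<gamma>' \<delta>' =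
     mat2 (\<alpha> * \<alpha>' + \<beta> * \<gamma>') (\<alpha> * \<beta>' + \<beta> * \<delta>') (\<gamma> * \<alpha>' + \<delta> * \<gamma>') (\<gamma> * \<beta>' + \<delta> * \<delta>')"
  by (rule eq_matI) (auto simp: mat2_def less_2_cases_iff scalar_prod_def numeral_2_eq_2)

lemma model2_dim [simp]: "dim_vec (model2 a0 a1 a2 b0 b1 b2) = 6"
  by (simp add: model2_def)

lemma model2_carrier [simp]: "model2 a0 a1 a2 b0 b1 b2 \<in> carrier_vec 6"
  by (rule carrier_vecI) simp

lemma model2_index [simp]:
  "model2 a0 a1 a2 b0 b1 b2 $ 0 = a0" "model2 a0 a1 a2 b0 b1 b2 $ Suc 0 = a1"
  "model2 a0 a1 a2 b0 b1 b2 $ 2 = a2" "model2 a0 a1 a2 b0 b1 b2 $ 3 = b0"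
  "model2 a0 a1 a2 b0 b1 b2 $ 4 = b1" "model2 a0 a1 a2 b0 b1 b2 $ 5 = b2"
  by (simp_all add: model2_def)

lemma eq_model2I:
  fixes w :: "'a vec"
  assumes "dim_vec w = 6" "w $ 0 = a0" "w $ 1 = a1" "w $ 2 = a2" "w $ 3 = b0" "w $ 4 = b1" "w $ 5 = b2"
  shows "w = model2 a0 a1 a2 b0 b1 b2"
proof (rule eq_vecI)
  fix i
  assume "i < dim_vec (model2 a0 a1 a2 b0 b1 b2)"
  then have "i = 0 \<or> i = 1 \<or> i = 2 \<or> i = 3 \<or> i = 4 \<or> i = 5"
    by auto
  then show "w $ i = model2 a0 a1 a2 b0 b1 b2 $ i"
    using assms by (elim disjE) simp_all
qed (use assms in simp)

lemma model2_eta: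
  assumes "w \<in> carrier_vec 6"
  obtains a0 a1 a2 b0 b1 b2 where "w = model2 a0 a1 a2 b0 b1 b2"
proof
  show "w = model2 (w $ 0) (w $ 1) (w $ 2) (w $ 3) (w $ 4) (w $ 5)"
    using assms by (intro eq_model2I) auto
qed

lemma vset_model2 [simp]: "set\<^sub>v (model2 a0 a1 a2 b0 b1 b2) = {a0, a1, a2, b0, b1, b2}"
proof -
  have "{..<6::nat} = {0, 1, 2, 3, 4, 5}"
    by auto
  then show ?thesis
    by (simp add: vec_set_def insert_commute)
qed

lemma smult_model2:
  "c \<cdot>\<^sub>v model2 a0 a1 a2 b0 b1 b2 =
     model2 (c * a0) (c * a1) (c * a2) (c * b0) (c * b1) (c * b2)"
  by (rule eq_model2I) auto

lemma map_model2:
  "map_vec f (model2 a0 a1 a2 b0 b1 b2) = model2 (f a0) (f a1) (f a2) (f b0) (f b1) (f b2)"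
  by (rule eq_model2I) auto

lemma model2_eq_iff:
  "model2 a0 a1 a2 b0 b1 b2 = model2 a0' a1' a2' b0' b1' b2' \<longleftrightarrow>
     a0 = a0' \<and> a1 = a1' \<and> a2 = a2' \<and> b0 = b0' \<and> b1 = b1' \<and> b2 = b2'"
proof
  assume eq: "model2 a0 a1 a2 b0 b1 b2 = model2 a0' a1' a2' b0' b1' b2'"
  have "model2 a0 a1 a2 b0 b1 b2 $ i = model2 a0' a1' a2' b0' b1' b2' $ i" for i
    by (simp only: eq)
  from this[of 0] this[of "Suc 0"] this[of 2] this[of 3] this[of 4] this[of 5]
  show "a0 = a0' \<and> a1 = a1' \<and> a2 = a2' \<and> b0 = b0' \<and> b1 = b1' \<and> b2 = b2'"
    by simp
qed simp

lemma coeffs_model2_index [simp]: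
  "coeffs_a 2 (model2 a0 a1 a2 b0 b1 b2) $ 0 = a0"
  "coeffs_a 2 (model2 a0 a1 a2 b0 b1 b2) $ Suc 0 = a1"
  "coeffs_a 2 (model2 a0 a1 a2 b0 b1 b2) $ 2 = a2"
  "coeffs_b 2 (model2 a0 a1 a2 b0 b1 b2) $ 0 = b0"
  "coeffs_b 2 (model2 a0 a1 a2 b0 b1 b2) $ Suc 0 = b1"
  "coeffs_b 2 (model2 a0 a1 a2 b0 b1 b2) $ 2 = b2"
  by (simp_all add: coeffs_a_def coeffs_b_def model2_def vec_first_def vec_last_def)

lemma form_eval_2:
  fixes u :: "'a vec"
  shows "form_eval e 2 u x y = e (u $ 0) * x ^ 2 + e (u $ 1) * x * y + e (u $ 2) * y ^ 2"
  by (simp add: form_eval_def numeral_2_eq_2)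

lemma form_resultant_model2:
  "form_resultant 2 (model2 a0 a1 a2 b0 b1 b2) =
     (a0 * b2 - a2 * b0) ^ 2 - (a0 * b1 - a1 * b0) * (a1 * b2 - a2 * b1)"
proof -
  \<comment> \<open>The forms are evaluated at X = variable, Y = 1, so a_0 and b_0 sit in top degree
    and the coefficient lists run backwards.\<close>
  let ?S = "sylvester_mat_sub 2 2 [:a2, a1, a0:] [:b2, b1, b0:]"
  have "?S = mat 4 4 (\<lambda>(i, j).
      [[a0, a1, a2, 0], [0, a0, a1, a2], [b0, b1, b2, 0], [0, b0, b1, b2]] ! i ! j)"
    by (intro eq_matI)
      (auto simp: sylvester_mat_sub_index numeral_eq_Suc less_Suc_eq)
  then have "det ?S = (a0 * b2 - a2 * b0) ^ 2 - (a0 * b1 - a1 * b0) * (a1 * b2 - a2 * b1)"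
    by (simp add: numeral_eq_Suc det_mat_Suc) (simp add: algebra_simps)
  then show ?thesis
    by (simp add: form_resultant_def form_eval_2 power2_eq_square algebra_simps)
qed

text \<open>The \<open>p\<close>s and \<open>q\<close>s are the coefficients of the two forms after
  the substitution; the adjugate then mixes them.\<close>

lemma conj_model2:
  "conj_model 2 (mat2 \<alpha> \<beta> \<gamma> \<delta>) (model2 a0 a1 a2 b0 b1 b2) =
    (let p0 = a0 * \<alpha>^2 + a1 * \<alpha> * \<gamma> + a2 * \<gamma>^2;
         p1 = 2 * a0 * \<alpha> * \<beta> + a1 * (\<alpha> * \<delta> + \<beta> * \<gamma>) + 2 * a2 * \<gamma> * \<delta>;
         p2 = a0 * \<beta>^2 + a1 * \<beta> * \<delta> + a2 * \<delta>^2;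
         q0 = b0 * \<alpha>^2 + b1 * \<alpha> * \<gamma> + b2 * \<gamma>^2;
         q1 = 2 * b0 * \<alpha> * \<beta> + b1 * (\<alpha> * \<delta> + \<beta> * \<gamma>) + 2 * b2 * \<gamma> * \<delta>;
         q2 = b0 * \<beta>^2 + b1 * \<beta> * \<delta> + b2 * \<delta>^2
     in model2 (\<delta> * p0 - \<beta> * q0) (\<delta> * p1 - \<beta> * q1) (\<delta> * p2 - \<beta> * q2)
               (\<alpha> * q0 - \<gamma> * p0) (\<alpha> * q1 - \<gamma> * p1) (\<alpha> * q2 - \<gamma> * p2))"
proof -
  have expand: "form_eval (\<lambda>c. [:c:]) 2 u [:\<alpha>, \<beta>:] [:\<gamma>, \<delta>:] =
      [:u $ 0 * \<alpha>^2 + u $ 1 * \<alpha> * \<gamma> + u $ 2 * \<gamma>^2,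
        2 * u $ 0 * \<alpha> * \<beta> + u $ 1 * (\<alpha> * \<delta> + \<beta> * \<gamma>) + 2 * u $ 2 * \<gamma> * \<delta>,
        u $ 0 * \<beta>^2 + u $ 1 * \<beta> * \<delta> + u $ 2 * \<delta>^2:]" for u :: "'a vec"
    by (simp add: form_eval_2 power2_eq_square algebra_simps)
  have coeff2: "coeff [:x, y, z:] 2 = z" for x y z :: 'a
    by (simp add: numeral_2_eq_2)
  show ?thesis
    unfolding Let_def
    by (rule eq_model2I) (simp_all add: conj_model_def Let_def expand coeff2)
qed

text \<open>Conjugation is a right action. This turns a matrix identity \<open>G * V = U * D\<close>
  into an identity between conjugated models.\<close>

lemma conj_model2_comp:
  assumes "G \<in> carrier_mat 2 2" "H \<in> carrier_mat 2 2" "w \<in> carrier_vec 6"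
  shows "conj_model 2 H (conj_model 2 G w) = conj_model 2 (G * H) w"
proof -
  obtain \<alpha> \<beta> \<gamma> \<delta> where G: "G = mat2 \<alpha> \<beta> \<gamma> \<delta>"
    using mat2_eta[OF assms(1)] .
  obtain \<alpha>' \<beta>' \<gamma>' \<delta>' where H: "H = mat2 \<alpha>' \<beta>' \<gamma>' \<delta>'"
    using mat2_eta[OF assms(2)] .
  obtain a0 a1 a2 b0 b1 b2 where w: "w = model2 a0 a1 a2 b0 b1 b2"
    using model2_eta[OF assms(3)] .
  show ?thesis
    unfolding G H w mat2_mult conj_model2 Let_def model2_eq_iff
    by (intro conjI; simp add: power2_eq_square algebra_simps)
qed

text \<open>In the minors of the 2 x 3 coefficient matrix the resultant is
  \<open>m02^2 - m01 * m12\<close>. The exponent is 2 + 2 + 2: the adjugate multiplies each minor by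
  D; the substitution multiplies each by D once more and acts on the triple as on the binary
  quadratic form \<open>m01 X^2 + 2 m02 X Y + m12 Y^2\<close>; the discriminant of that form
  acquires \<open>D^2\<close>.\<close>

lemma form_resultant_conj_model2:
  assumes "G \<in> carrier_mat 2 2" "w \<in> carrier_vec 6"
  shows "form_resultant 2 (conj_model 2 G w) = det G ^ 6 * form_resultant 2 w"
proof -
  obtain \<alpha> \<beta> \<gamma> \<delta> where G: "G = mat2 \<alpha> \<beta> \<gamma> \<delta>"
    using mat2_eta[OF assms(1)] .
  obtain a0 a1 a2 b0 b1 b2 where w: "w = model2 a0 a1 a2 b0 b1 b2"
    using model2_eta[OF assms(2)] .
  define D where "D = \<alpha> * \<delta> - \<beta> * \<gamma>"
  define m01 m02 m12 where "m01 = a0 * b1 - a1 * b0" and "m02 = a0 * b2 - a2 * b0"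
    and "m12 = a1 * b2 - a2 * b1"
  note m = m01_def m02_def m12_def
  let ?p0 = "a0 * \<alpha>^2 + a1 * \<alpha> * \<gamma> + a2 * \<gamma>^2"
  let ?p1 = "2 * a0 * \<alpha> * \<beta> + a1 * (\<alpha> * \<delta> + \<beta> * \<gamma>) + 2 * a2 * \<gamma> * \<delta>"
  let ?p2 = "a0 * \<beta>^2 + a1 * \<beta> * \<delta> + a2 * \<delta>^2"
  let ?q0 = "b0 * \<alpha>^2 + b1 * \<alpha> * \<gamma> + b2 * \<gamma>^2"
  let ?q1 = "2 * b0 * \<alpha> * \<beta> + b1 * (\<alpha> * \<delta> + \<beta> * \<gamma>) + 2 * b2 * \<gamma> * \<delta>"
  let ?q2 = "b0 * \<beta>^2 + b1 * \<beta> * \<delta> + b2 * \<delta>^2"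
  have adj: "(\<delta> * x - \<beta> * y) * (\<alpha> * y' - \<gamma> * x') - (\<delta> * x' - \<beta> * y') * (\<alpha> * y - \<gamma> * x) =
      D * (x * y' - x' * y)" for x y x' y'
    by (simp add: D_def algebra_simps)
  have "?p0 * ?q1 - ?p1 * ?q0 = D * (\<alpha>^2 * m01 + 2 * \<alpha> * \<gamma> * m02 + \<gamma>^2 * m12)"
    "?p0 * ?q2 - ?p2 * ?q0 = D * (\<alpha> * \<beta> * m01 + (\<alpha> * \<delta> + \<beta> * \<gamma>) * m02 + \<gamma> * \<delta> * m12)"
    "?p1 * ?q2 - ?p2 * ?q1 = D * (\<beta>^2 * m01 + 2 * \<beta> * \<delta> * m02 + \<delta>^2 * m12)"
    by (simp_all add: D_def m power2_eq_square algebra_simps)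
  then have "form_resultant 2 (conj_model 2 G w) =
      (D * (D * (\<alpha> * \<beta> * m01 + (\<alpha> * \<delta> + \<beta> * \<gamma>) * m02 + \<gamma> * \<delta> * m12)))^2
      - D * (D * (\<alpha>^2 * m01 + 2 * \<alpha> * \<gamma> * m02 + \<gamma>^2 * m12)) *
        (D * (D * (\<beta>^2 * m01 + 2 * \<beta> * \<delta> * m02 + \<delta>^2 * m12)))"
    unfolding G w conj_model2 Let_def form_resultant_model2 adj by (simp only:)
  also have "\<dots> = D ^ 4 * ((\<alpha> * \<beta> * m01 + (\<alpha> * \<delta> + \<beta> * \<gamma>) * m02 + \<gamma> * \<delta> * m12)^2
      - (\<alpha>^2 * m01 + 2 * \<alpha> * \<gamma> * m02 + \<gamma>^2 * m12) * (\<beta>^2 * m01 + 2 * \<beta> * \<delta> * m02 + \<delta>^2 * m12))"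
    by (simp add: power_mult_distrib right_diff_distrib eval_nat_numeral mult_ac)
  also have "(\<alpha> * \<beta> * m01 + (\<alpha> * \<delta> + \<beta> * \<gamma>) * m02 + \<gamma> * \<delta> * m12)^2
      - (\<alpha>^2 * m01 + 2 * \<alpha> * \<gamma> * m02 + \<gamma>^2 * m12) * (\<beta>^2 * m01 + 2 * \<beta> * \<delta> * m02 + \<delta>^2 * m12)
      = D^2 * (m02^2 - m01 * m12)"
    by (simp add: D_def power2_eq_square algebra_simps)
  also have "D^4 * (D^2 * (m02^2 - m01 * m12)) = D^6 * (m02^2 - m01 * m12)"
    by (simp add: eval_nat_numeral mult_ac)
  finally show ?thesis
    by (simp add: G w det_mat2 form_resultant_model2 D_def m)
qed


section \<open>Presentations in degree two\<close>

lemma quadratic_form_factors: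
  fixes a0 a1 a2 :: "'a::alg_closed_field"
  obtains p q r s where "a0 = p * r" "a1 = p * s + q * r" "a2 = q * s"
proof (cases "a0 = 0")
  case True
  then show ?thesis
    \<comment> \<open>The witnesses fill \<open>p\<close>, \<open>r\<close>, \<open>s\<close>,
      \<open>q\<close> in this order: the form is \<open>Y * (a1 X + a2 Y)\<close>.\<close>
    by (intro that[of 0 a1 a2 1]) auto
next
  case False
  then have "degree [:a2, a1, a0:] > 0"
    by simp
  then obtain z where "poly [:a2, a1, a0:] z = 0"
    using alg_closed_imp_poly_has_root by blast
  then have "a2 = - z * (a1 + a0 * z)"
    by (simp add: algebra_simps eq_neg_iff_add_eq_0)
  then show ?thesis
    by (intro that[of 1 a0 "a1 + a0 * z" "- z"]) (auto simp: algebra_simps)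
qed

lemma linear_forms_common_zero:
  fixes p q p' q' :: "'a::field"
  assumes "p * q' - q * p' = 0"
  obtains x y where "(x, y) \<noteq> (0, 0)" "p * x + q * y = 0" "p' * x + q' * y = 0"
proof (cases "p = 0 \<and> q = 0")
  case True
  then show ?thesis
    using that[of "q'" "- p'"] that[of 1 0] by (cases "p' = 0 \<and> q' = 0") (auto simp: algebra_simps)
next
  case False
  then show ?thesis
    using assms by (intro that[of q "- p"]) (auto simp: algebra_simps)
qed

text \<open>Once both forms are split into linear factors, the resultant is the product of the four
  determinants pairing a factor of one with a factor of the other; a vanishing determinant gives a
  shared zero.\<close>

lemma quadratic_forms_common_zero:
  fixes a0 a1 a2 b0 b1 b2 :: "'a::alg_closed_field"
  assumes "(a0 * b2 - a2 * b0) ^ 2 - (a0 * b1 - a1 * b0) * (a1 * b2 - a2 * b1) = 0"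
  obtains x y where "(x, y) \<noteq> (0, 0)" "a0 * x^2 + a1 * x * y + a2 * y^2 = 0"
    "b0 * x^2 + b1 * x * y + b2 * y^2 = 0"
proof -
  obtain p q r s where a: "a0 = p * r" "a1 = p * s + q * r" "a2 = q * s"
    by (rule quadratic_form_factors)
  obtain p' q' r' s' where b: "b0 = p' * r'" "b1 = p' * s' + q' * r'" "b2 = q' * s'"
    by (rule quadratic_form_factors)
  have fa: "a0 * x^2 + a1 * x * y + a2 * y^2 = (p * x + q * y) * (r * x + s * y)" for x y
    unfolding a by (simp add: power2_eq_square algebra_simps)
  have fb: "b0 * x^2 + b1 * x * y + b2 * y^2 = (p' * x + q' * y) * (r' * x + s' * y)" for x y
    unfolding b by (simp add: power2_eq_square algebra_simps)
  have "(a0 * b2 - a2 * b0) ^ 2 - (a0 * b1 - a1 * b0) * (a1 * b2 - a2 * b1) =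
      ((p * q' - q * p') * (p * s' - q * r')) * ((r * q' - s * p') * (r * s' - s * r'))"
    unfolding a b by (simp add: power2_eq_square algebra_simps)
  then consider "p * q' - q * p' = 0" | "p * s' - q * r' = 0" | "r * q' - s * p' = 0"
    | "r * s' - s * r' = 0"
    using assms by auto
  then show ?thesis
  proof cases
    case 1
    then obtain x y where "(x, y) \<noteq> (0, 0)" "p * x + q * y = 0" "p' * x + q' * y = 0"
      by (rule linear_forms_common_zero)
    then show ?thesis
      by (intro that[of x y]) (simp_all add: fa fb)
  next
    case 2
    then obtain x y where "(x, y) \<noteq> (0, 0)" "p * x + q * y = 0" "r' * x + s' * y = 0"
      by (rule linear_forms_common_zero)
    then show ?thesis
      by (intro that[of x y]) (simp_all add: fa fb)
  next
    case 3
    then obtain x y where "(x, y) \<noteq> (0, 0)" "r * x + s * y = 0" "p' * x + q' * y = 0"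
      by (rule linear_forms_common_zero)
    then show ?thesis
      by (intro that[of x y]) (simp_all add: fa fb)
  next
    case 4
    then obtain x y where "(x, y) \<noteq> (0, 0)" "r * x + s * y = 0" "r' * x + s' * y = 0"
      by (rule linear_forms_common_zero)
    then show ?thesis
      by (intro that[of x y]) (simp_all add: fa fb)
  qed
qed

lemma no_common_zero_imp_form_resultant:
  assumes "w \<in> carrier_vec 6" "no_common_zero 2 w"
  shows "form_resultant 2 w \<noteq> 0"
proof
  assume R: "form_resultant 2 w = 0"
  obtain a0 a1 a2 b0 b1 b2 where w: "w = model2 a0 a1 a2 b0 b1 b2"
    using model2_eta[OF assms(1)] .
  have "(to_ac a0 * to_ac b2 - to_ac a2 * to_ac b0) ^ 2 -
      (to_ac a0 * to_ac b1 - to_ac a1 * to_ac b0) * (to_ac a1 * to_ac b2 - to_ac a2 * to_ac b1) =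
      to_ac (form_resultant 2 w)"
    by (simp add: w form_resultant_model2)
  also have "\<dots> = 0"
    by (simp add: R)
  finally obtain x y where "(x, y) \<noteq> (0, 0)"
    "to_ac a0 * x^2 + to_ac a1 * x * y + to_ac a2 * y^2 = 0"
    "to_ac b0 * x^2 + to_ac b1 * x * y + to_ac b2 * y^2 = 0"
    by (rule quadratic_forms_common_zero)
  then show False
    using assms(2) by (auto simp: no_common_zero_def w form_eval_2)
qed

section \<open>Uniqueness of the presentation of a quadratic map\<close>

text \<open>The equations are the coefficients of
  \<open>F_a * (y1 X + y2 Y) = F_b * (x1 X + x2 Y)\<close>, a linear system with the Sylvester
  matrix up to signs and transposition. The multipliers in the proof are its cofactors, as in
  Cramer's rule.\<close>

lemma sylvester_system_trivial:
  fixes a0 a1 a2 b0 b1 b2 :: "'a::idom"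
  assumes \<rho>: "(a0 * b2 - a2 * b0) ^ 2 - (a0 * b1 - a1 * b0) * (a1 * b2 - a2 * b1) \<noteq> 0"
    and e: "a0 * y1 - b0 * x1 = 0" "a0 * y2 + a1 * y1 - b0 * x2 - b1 * x1 = 0"
      "a1 * y2 + a2 * y1 - b1 * x2 - b2 * x1 = 0" "a2 * y2 - b2 * x2 = 0"
  shows "x1 = 0 \<and> x2 = 0 \<and> y1 = 0 \<and> y2 = 0"
proof -
  let ?\<rho> = "(a0 * b2 - a2 * b0) ^ 2 - (a0 * b1 - a1 * b0) * (a1 * b2 - a2 * b1)"
  let ?e1 = "a0 * y1 - b0 * x1" and ?e2 = "a0 * y2 + a1 * y1 - b0 * x2 - b1 * x1"
  let ?e3 = "a1 * y2 + a2 * y1 - b1 * x2 - b2 * x1" and ?e4 = "a2 * y2 - b2 * x2"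
  have "?\<rho> * y1 = (a0 * b2 * b2 - a1 * b1 * b2 + a2 * b1 * b1 - a2 * b0 * b2) * ?e1
      + (a1 * b0 * b2 - a2 * b0 * b1) * ?e2 + (a2 * b0 * b0 - a0 * b0 * b2) * ?e3
      + (a0 * b0 * b1 - a1 * b0 * b0) * ?e4"
    by (simp add: power2_eq_square algebra_simps)
  moreover have "?\<rho> * y2 = (a2 * b1 * b2 - a1 * b2 * b2) * ?e1 + (a0 * b2 * b2 - a2 * b0 * b2) * ?e2
      + (a1 * b0 * b2 - a0 * b1 * b2) * ?e3
      + (a0 * b1 * b1 - a0 * b0 * b2 - a1 * b0 * b1 + a2 * b0 * b0) * ?e4"
    by (simp add: power2_eq_square algebra_simps)
  moreover have "?\<rho> * x1 = (a1 * a2 * b1 - a1 * a1 * b2 + a0 * a2 * b2 - a2 * a2 * b0) * ?e1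
      + (a0 * a1 * b2 - a0 * a2 * b1) * ?e2 + (a0 * a2 * b0 - a0 * a0 * b2) * ?e3
      + (a0 * a0 * b1 - a0 * a1 * b0) * ?e4"
    by (simp add: power2_eq_square algebra_simps)
  moreover have "?\<rho> * x2 = (a2 * a2 * b1 - a1 * a2 * b2) * ?e1 + (a0 * a2 * b2 - a2 * a2 * b0) * ?e2
      + (a1 * a2 * b0 - a0 * a2 * b1) * ?e3
      + (a0 * a1 * b1 - a0 * a0 * b2 - a1 * a1 * b0 + a0 * a2 * b0) * ?e4"
    by (simp add: power2_eq_square algebra_simps)
  ultimately have "?\<rho> * y1 = 0" "?\<rho> * y2 = 0" "?\<rho> * x1 = 0" "?\<rho> * x2 = 0"
    by (simp_all only: e mult_zero_right add_0_right)
  then show ?thesis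
    using \<rho> by simp
qed

lemma poly_vanishing_everywhere:
  fixes p :: "'a::idom poly"
  assumes "infinite (UNIV :: 'a set)" "\<And>z. poly p z = 0"
  shows "p = 0"
  using assms poly_roots_finite[of p] by auto

text \<open>Coprimality of F_a and F_b is used through linear algebra instead of factorization:
  after subtracting a multiple that matches the coefficients of \<open>X^2\<close>, both differences
  are Y times linear forms, and the Sylvester system kills these.\<close>

lemma proportional_models:
  fixes a0 a1 a2 b0 b1 b2 :: "'a::field"
  assumes \<rho>: "(a0 * b2 - a2 * b0) ^ 2 - (a0 * b1 - a1 * b0) * (a1 * b2 - a2 * b1) \<noteq> 0"
    and inf: "infinite (UNIV :: 'a set)"
    and cross: "\<And>z. (a0 + a1 * z + a2 * z^2) * (b0' + b1' * z + b2' * z^2) =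
      (a0' + a1' * z + a2' * z^2) * (b0 + b1 * z + b2 * z^2)"
  shows "\<exists>l. model2 a0' a1' a2' b0' b1' b2' = l \<cdot>\<^sub>v model2 a0 a1 a2 b0 b1 b2"
proof -
  have "[:a0, a1, a2:] * [:b0', b1', b2':] - [:a0', a1', a2':] * [:b0, b1, b2:] = 0"
    using cross by (intro poly_vanishing_everywhere inf) (simp add: power2_eq_square algebra_simps)
  then have e: "a0 * b0' - b0 * a0' = 0" "a0 * b1' + a1 * b0' - b0 * a1' - b1 * a0' = 0"
      "a0 * b2' + a1 * b1' + a2 * b0' - b0 * a2' - b1 * a1' - b2 * a0' = 0"
      "a1 * b2' + a2 * b1' - b1 * a2' - b2 * a1' = 0" "a2 * b2' - b2 * a2' = 0"
    by (simp_all add: algebra_simps)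
  have "a0 \<noteq> 0 \<or> b0 \<noteq> 0"
    using \<rho> by auto
  then obtain l where l: "a0' = l * a0" "b0' = l * b0"
  proof
    assume "a0 \<noteq> 0"
    then show ?thesis
      using e(1) by (intro that[of "a0' / a0"]) (auto simp: field_simps)
  next
    assume "b0 \<noteq> 0"
    then show ?thesis
      using e(1) by (intro that[of "b0' / b0"]) (auto simp: field_simps)
  qed
  have "a1' - l * a1 = 0 \<and> a2' - l * a2 = 0 \<and> b1' - l * b1 = 0 \<and> b2' - l * b2 = 0"
    using e(2-) by (intro sylvester_system_trivial[OF \<rho>]) (simp_all add: l algebra_simps)
  then show ?thesis
    by (intro exI[of _ l]) (simp add: l smult_model2)
qed

lemma proj_line_pt_eq_imp_cross:
  assumes "proj_line_pt x y = proj_line_pt x' y'"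
  shows "x * y' = x' * y"
proof -
  have "vec_of_list [x', y'] \<in> proj_line_pt x' y'"
    by (auto simp: proj_line_pt_def proj_rel_def intro!: exI[of _ 1])
  then have "vec_of_list [x', y'] \<in> proj_line_pt x y"
    using assms by simp
  then obtain c where c: "vec_of_list [x', y'] = c \<cdot>\<^sub>v vec_of_list [x, y]"
    by (auto simp: proj_line_pt_def proj_rel_def)
  have "x' = c * x" "y' = c * y"
    using arg_cong[OF c, of "\<lambda>u. vec_index u 0"] arg_cong[OF c, of "\<lambda>u. vec_index u 1"] by simp_all
  then show ?thesis
    by simp
qed

lemma proj_space_cases:
  assumes "\<Phi> \<in> proj_space n"
  obtains w where "w \<in> carrier_vec (n + 1)" "w \<noteq> 0\<^sub>v (n + 1)" "\<Phi> = {c \<cdot>\<^sub>v w | c. c \<noteq> 0}"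
  using assms by (auto simp: proj_space_def quotient_def proj_rel_def)

lemma presentation_unique:
  fixes \<Phi> \<Phi>' :: "'a::field vec set"
  assumes inf: "infinite (UNIV :: 'a set)"
    and "is_presentation 2 \<phi> \<Phi>" "is_presentation 2 \<phi> \<Phi>'"
  shows "\<Phi> = \<Phi>'"
proof -
  obtain w where w: "w \<in> carrier_vec 6" "\<Phi> = {c \<cdot>\<^sub>v w | c. c \<noteq> 0}"
    using assms(2) by (auto simp: is_presentation_def elim: proj_space_cases)
  obtain w' where w': "w' \<in> carrier_vec 6" "w' \<noteq> 0\<^sub>v 6" "\<Phi>' = {c \<cdot>\<^sub>v w' | c. c \<noteq> 0}"
    using assms(3) by (auto simp: is_presentation_def elim: proj_space_cases)
  have wi: "w \<in> \<Phi>" "w' \<in> \<Phi>'"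
    by (auto simp: w(2) w'(3) intro!: exI[of _ 1])
  obtain a0 a1 a2 b0 b1 b2 where a: "w = model2 a0 a1 a2 b0 b1 b2"
    using model2_eta[OF w(1)] .
  obtain a0' a1' a2' b0' b1' b2' where a': "w' = model2 a0' a1' a2' b0' b1' b2'"
    using model2_eta[OF w'(1)] .
  have "\<exists>l. w' = l \<cdot>\<^sub>v w"
    unfolding a a'
  proof (rule proportional_models[OF _ inf])
    show "(a0 * b2 - a2 * b0) ^ 2 - (a0 * b1 - a1 * b0) * (a1 * b2 - a2 * b1) \<noteq> 0"
      using no_common_zero_imp_form_resultant[OF w(1)] assms(2) wi(1)
      by (auto simp: is_presentation_def a form_resultant_model2)
    \<comment> \<open>The points [1 : z] with z in K suffice: equality of their images is a
      vanishing cross product, which descends to K because \<open>to_ac\<close> is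
      injective.\<close>
    fix z :: 'a
    let ?F = "\<lambda>u. form_eval to_ac 2 u 1 (to_ac z)"
    have "proj_line_pt (?F (coeffs_a 2 w)) (?F (coeffs_b 2 w)) = \<phi> (proj_line_pt 1 (to_ac z))"
      using assms(2) wi(1) by (simp add: is_presentation_def)
    also have "\<dots> = proj_line_pt (?F (coeffs_a 2 w')) (?F (coeffs_b 2 w'))"
      using assms(3) wi(2) by (simp add: is_presentation_def)
    finally have "?F (coeffs_a 2 w) * ?F (coeffs_b 2 w') = ?F (coeffs_a 2 w') * ?F (coeffs_b 2 w)"
      by (rule proj_line_pt_eq_imp_cross)
    then have "to_ac ((a0 + a1 * z + a2 * z^2) * (b0' + b1' * z + b2' * z^2)) =
        to_ac ((a0' + a1' * z + a2' * z^2) * (b0 + b1 * z + b2 * z^2))"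
      by (simp add: a a' form_eval_2)
    then show "(a0 + a1 * z + a2 * z^2) * (b0' + b1' * z + b2' * z^2) =
        (a0' + a1' * z + a2' * z^2) * (b0 + b1 * z + b2 * z^2)"
      by (simp only: to_ac_eq_iff)
  qed
  then obtain l where l: "w' = l \<cdot>\<^sub>v w"
    by blast
  have "l \<noteq> 0"
    using w'(2) w(1) by (auto simp: l)
  have "\<Phi>' \<subseteq> \<Phi>"
    using \<open>l \<noteq> 0\<close> by (auto simp: w(2) w'(3) l smult_smult_assoc)
  moreover have "\<Phi> \<subseteq> \<Phi>'"
  proof
    fix u
    assume "u \<in> \<Phi>"
    then obtain c where "c \<noteq> 0" "u = c \<cdot>\<^sub>v w"
      by (auto simp: w(2))
    then show "u \<in> \<Phi>'"
      using \<open>l \<noteq> 0\<close> by (auto simp: w'(3) l smult_smult_assoc intro!: exI[of _ "c / l"])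
  qed
  ultimately show ?thesis
    by blast
qed


section \<open>Algebraic relations in a function field\<close>

text \<open>Indexed families matter here, since different monomials may be equal as elements of K. A
  coincidence is itself a relation; without one the family is injective and the dimension bound
  applies to its image.\<close>

lemma (in vector_space) nontrivial_relation:
  assumes "finite T" "finite I" "card T < card I" "\<And>i. i \<in> I \<Longrightarrow> f i \<in> span T"
  shows "\<exists>c. (\<exists>i\<in>I. c i \<noteq> 0) \<and> (\<Sum>i\<in>I. c i *s f i) = 0"
proof (rule ccontr)
  assume "\<not> ?thesis"
  then have triv: "(\<Sum>i\<in>I. c i *s f i) = 0 \<Longrightarrow> i \<in> I \<Longrightarrow> c i = 0" for c i
    by blast
  have inj: "inj_on f I"
  proof (rule inj_onI, rule ccontr)
    fix i j
    assume ij: "i \<in> I" "j \<in> I" "f i = f j" "i \<noteq> j"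
    let ?c = "\<lambda>l. if l = i then 1 else if l = j then - 1 else 0"
    have "(\<Sum>l\<in>I. ?c l *s f l) = (\<Sum>l\<in>I. (if l = i then f i else 0) - (if l = j then f j else 0))"
      using ij by (intro sum.cong) auto
    also have "\<dots> = 0"
      using ij assms(2) by (simp add: sum_subtractf sum.delta)
    finally show False
      using triv[of ?c i] ij by simp
  qed
  have "independent (f ` I)"
  proof (rule independent_if_scalars_zero)
    fix g y
    assume "(\<Sum>y\<in>f ` I. g y *s y) = 0" "y \<in> f ` I"
    then show "g y = 0"
      using triv[of "\<lambda>i. g (f i)"] by (auto simp: sum.reindex[OF inj])
  qed (use assms(2) in simp)
  then have "card (f ` I) \<le> card T"
    using independent_span_bound[OF assms(1)] assms(4) by blast
  then show False
    using assms(3) card_image[OF inj] by simp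
qed

text \<open>The product of all denominators works; transcendence of \<open>t\<close> keeps their
  values nonzero.\<close>

lemma (in field_hom) common_denominator:
  assumes "finite Y" "\<And>y. y \<in> Y \<Longrightarrow> y \<in> adjoined_field hom t"
    and trans: "\<And>f. poly (map_poly hom f) t = 0 \<Longrightarrow> f = 0"
  shows "\<exists>g. g \<noteq> 0 \<and> (\<forall>y\<in>Y. \<exists>f. poly (map_poly hom g) t * y = poly (map_poly hom f) t)"
  using assms(1,2)
proof (induction Y rule: finite_induct)
  case empty
  show ?case by (rule exI[of _ 1]) simp
next
  case (insert y Y)
  interpret mp: map_poly_idom_hom hom ..
  obtain g where g: "g \<noteq> 0" "\<forall>y\<in>Y. \<exists>f. poly (map_poly hom g) t * y = poly (map_poly hom f) t"
    using insert by blast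
  obtain p q where pq: "y = poly (map_poly hom p) t / poly (map_poly hom q) t" "q \<noteq> 0"
    using insert.prems[of y] by (auto simp: adjoined_field_def)
  have q0: "poly (map_poly hom q) t \<noteq> 0"
    using trans[of q] pq(2) by blast
  have "\<exists>f. poly (map_poly hom (g * q)) t * z = poly (map_poly hom f) t" if "z \<in> insert y Y" for z
  proof (cases "z = y")
    case True
    then show ?thesis
      using pq(1) q0 by (intro exI[of _ "g * p"]) (simp add: mp.hom_mult)
  next
    case False
    then obtain f where "poly (map_poly hom g) t * z = poly (map_poly hom f) t"
      using g(2) \<open>z \<in> insert y Y\<close> by blast
    then show ?thesis
      by (intro exI[of _ "q * f"]) (simp add: mp.hom_mult mult_ac)
  qed
  then show ?case
    using g(1) pq(2) by (intro exI[of _ "g * q"]) auto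
qed

text \<open>
  Multiplication by \<open>x\<close> and by \<open>u\<close>, cleared of denominators, raises degrees in \<open>t\<close> by a bounded
  amount.  So the $(n+1)^2$ monomials of degree at most $n$ in each of \<open>x\<close>, \<open>u\<close> lie in a
  space whose dimension grows only linearly in $n$.
\<close>
lemma (in field_hom) function_field_algebraic_relation:
  assumes "function_field hom"
  shows "\<exists>n c. (\<exists>i\<le>n. \<exists>j\<le>n. c i j \<noteq> 0) \<and> (\<Sum>j\<le>n. (\<Sum>i\<le>n. hom (c i j) * x ^ i) * u ^ j) = 0"
proof -
  interpret mp: map_poly_idom_hom hom ..
  interpret vs: vector_space "\<lambda>c y. hom c * y"
    by unfold_locales (simp_all add: hom_distribs algebra_simps)
  obtain t B where trans: "\<And>f. poly (map_poly hom f) t = 0 \<Longrightarrow> f = 0" and fB: "finite B"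
    and sp: "\<And>y. \<exists>c. (\<forall>b\<in>B. c b \<in> adjoined_field hom t) \<and> y = (\<Sum>b\<in>B. c b * b)"
    using assms unfolding function_field_def by blast
  \<comment> \<open>The elements whose coordinates are cleared of denominators: 1 starts every
    monomial, and \<open>z * b\<close> for z = 1, x, u describes multiplication by z on the
    generators.\<close>
  define Y where "Y = insert 1 (B \<union> (*) x ` B \<union> (*) u ` B)"
  have fY: "finite Y"
    using fB by (simp add: Y_def)
  have "\<forall>y. \<exists>c. (\<forall>b\<in>B. c b \<in> adjoined_field hom t) \<and> y = (\<Sum>b\<in>B. c b * b)"
    using sp by blast
  from choice[OF this] obtain c
    where c: "\<And>y b. b \<in> B \<Longrightarrow> c y b \<in> adjoined_field hom t" "\<And>y. y = (\<Sum>b\<in>B. c y b * b)"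
    by blast
  let ?E = "\<lambda>f. poly (map_poly hom f) t"
  obtain g where g: "g \<noteq> 0" "\<forall>z\<in>(\<lambda>(y, b). c y b) ` (Y \<times> B). \<exists>f. ?E g * z = ?E f"
  proof -
    have "finite ((\<lambda>(y, b). c y b) ` (Y \<times> B))"
      using fY fB by simp
    moreover have "z \<in> adjoined_field hom t" if "z \<in> (\<lambda>(y, b). c y b) ` (Y \<times> B)" for z
      using that c(1) by auto
    ultimately show ?thesis
      using common_denominator[OF _ _ trans] that by blast
  qed
  then have "\<forall>y\<in>Y. \<forall>b\<in>B. \<exists>f. ?E g * c y b = ?E f"
    by auto
  then obtain f where f: "\<forall>y\<in>Y. \<forall>b\<in>B. ?E g * c y b = ?E (f y b)"
    by (auto simp: bchoice_iff)
  define D where "D = ?E g"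
  have D0: "D \<noteq> 0"
    using trans[of g] g(1) by (auto simp: D_def)
  define e where "e = (\<Sum>y\<in>Y. \<Sum>b\<in>B. degree (f y b))"
  \<comment> \<open>The span of \<open>T r\<close> over k consists of the combinations of
    \<open>B\<close> with polynomial coefficients in \<open>t\<close> of degree at most
    \<open>r\<close>.\<close>
  define T where "T r = (\<lambda>(l, b). t ^ l * b) ` ({..r} \<times> B)" for r :: nat
  let ?M = "\<lambda>r. vs.span (T r)"
  have T_mono: "T r \<subseteq> T s" if "r \<le> s" for r s
    using that by (auto simp: T_def)
  have poly_in: "?E p * b \<in> ?M r" if "degree p \<le> r" "b \<in> B" for p b r
  proof -
    have "t ^ i * b \<in> ?M r" if "i \<le> degree (map_poly hom p)" for i
      using that \<open>degree p \<le> r\<close> \<open>b \<in> B\<close> degree_map_poly_le[of hom p]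
      by (intro vs.span_base) (auto simp: T_def intro!: rev_image_eqI[of "(i, b)"])
    then have "(\<Sum>i\<le>degree (map_poly hom p). hom (coeff p i) * (t ^ i * b)) \<in> ?M r"
      by (intro vs.span_sum vs.span_scale) auto
    also have "(\<Sum>i\<le>degree (map_poly hom p). hom (coeff p i) * (t ^ i * b)) = ?E p * b"
      unfolding poly_altdef sum_distrib_right by (simp add: mult.assoc)
    finally show ?thesis .
  qed
  have Y_in: "D * y \<in> ?M e" if "y \<in> Y" for y
  proof -
    have "D * y = D * (\<Sum>b\<in>B. c y b * b)"
      using c(2)[of y] by (rule arg_cong)
    also have "\<dots> = (\<Sum>b\<in>B. ?E (f y b) * b)"
      unfolding sum_distrib_left D_def
      by (intro sum.cong refl) (simp add: f[rule_format, OF that, symmetric] mult.assoc)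
    finally have "D * y = (\<Sum>b\<in>B. ?E (f y b) * b)" .
    moreover have "degree (f y b) \<le> e" if "b \<in> B" for b
    proof -
      have "degree (f y b) \<le> (\<Sum>b\<in>B. degree (f y b))"
        using fB \<open>b \<in> B\<close> by (intro member_le_sum) auto
      also have "\<dots> \<le> e"
        unfolding e_def using fY \<open>y \<in> Y\<close> by (intro member_le_sum) auto
      finally show ?thesis .
    qed
    ultimately show ?thesis
      using poly_in by (auto intro!: vs.span_sum)
  qed
  have span_mult: "a * m \<in> vs.span T'" if "\<And>s. s \<in> S \<Longrightarrow> a * s \<in> vs.span T'" "m \<in> vs.span S"
    for a m S T'
  proof -
    have "vs.subspace {m. a * m \<in> vs.span T'}"
      by (auto simp: vs.subspace_def distrib_left mult.left_commute[of a]
          intro: vs.span_add vs.span_scale vs.span_zero)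
    then have "vs.span S \<subseteq> {m. a * m \<in> vs.span T'}"
      using that(1) by (intro vs.span_minimal) auto
    then show ?thesis
      using that(2) by auto
  qed
  have t_mult: "t ^ l * m \<in> ?M (e + l)" if "m \<in> ?M e" for l m
  proof (rule span_mult[OF _ that])
    fix s
    assume "s \<in> T e"
    then obtain i b where "i \<le> e" "b \<in> B" "s = t ^ i * b"
      by (auto simp: T_def)
    then show "t ^ l * s \<in> ?M (e + l)"
      by (intro vs.span_base)
        (auto simp: T_def power_add mult_ac intro!: rev_image_eqI[of "(i + l, b)"])
  qed
  \<comment> \<open>\<open>D\<close> clears the denominators of \<open>z * b\<close>, so one
    multiplication raises the degree in \<open>t\<close> by at most \<open>e\<close>.\<close>
  have step: "(D * z) * m \<in> ?M (r + e)" if z: "z \<in> {1, x, u}" and m: "m \<in> ?M r" for z m r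
  proof (rule span_mult[OF _ m])
    fix s
    assume "s \<in> T r"
    then obtain l b where lb: "l \<le> r" "b \<in> B" "s = t ^ l * b"
      by (auto simp: T_def)
    have "z * b \<in> Y"
      using z lb(2) by (auto simp: Y_def)
    then have "t ^ l * (D * (z * b)) \<in> ?M (e + l)"
      by (intro t_mult Y_in)
    moreover have "?M (e + l) \<subseteq> ?M (r + e)"
      using lb(1) by (intro vs.span_mono T_mono) simp
    ultimately show "(D * z) * s \<in> ?M (r + e)"
      by (auto simp: lb(3) mult_ac)
  qed
  have iter: "(D * z) ^ k * m \<in> ?M (r + k * e)" if "z \<in> {1, x, u}" "m \<in> ?M r" for z m r k
  proof (induction k)
    case (Suc k)
    show ?case
      using step[OF that(1) Suc] by (simp add: mult_ac add_ac)
  qed (use that in simp)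
  \<comment> \<open>All monomials must carry the same power of \<open>D\<close>, to be cancelled at
    the end: \<open>i\<close> factors come from x, \<open>j\<close> from u, \<open>k\<close> from
    padding with z = 1, and one from the initial \<open>D * 1\<close>.\<close>
  have monom_in: "D ^ (2 * n + 1) * (x ^ i * u ^ j) \<in> ?M (e + 2 * n * e)" if "i \<le> n" "j \<le> n" for i j n
  proof -
    have "i + j \<le> 2 * n"
      using that by simp
    then obtain k where k: "2 * n = i + j + k"
      using le_Suc_ex by blast
    have "D * 1 \<in> ?M e"
      by (rule Y_in) (simp add: Y_def)
    from iter[OF _ iter[OF _ iter[OF _ this, of 1 k], of u j], of x i]
    have "(D * x) ^ i * ((D * u) ^ j * ((D * 1) ^ k * (D * 1))) \<in> ?M (e + k * e + j * e + i * e)"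
      by simp
    also have "(D * x) ^ i * ((D * u) ^ j * ((D * 1) ^ k * (D * 1))) =
        D ^ (2 * n + 1) * (x ^ i * u ^ j)"
      unfolding k by (simp add: power_mult_distrib power_add mult_ac)
    also have "e + k * e + j * e + i * e = e + 2 * n * e"
      unfolding k by (simp add: algebra_simps)
    finally show ?thesis .
  qed
  \<comment> \<open>Chosen so that twice the number of generators is at most
    \<open>(2 * n + 1) * n\<close>, which is less than \<open>2 * (n + 1)^2\<close>.\<close>
  define n where "n = 2 * card B * (e + 1)"
  define I where "I = {..n} \<times> {..n}"
  have "card (T (e + 2 * n * e)) \<le> (e + 2 * n * e + 1) * card B"
    using card_image_le[of "{..e + 2 * n * e} \<times> B" "\<lambda>(l, b). t ^ l * b"] fB
    by (simp add: T_def)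
  also have "\<dots> < (n + 1) * (n + 1)"
  proof -
    have "2 * ((e + 2 * n * e + 1) * card B) \<le> 2 * ((2 * n + 1) * (e + 1) * card B)"
      by (intro mult_le_mono) (auto simp: algebra_simps)
    also have "\<dots> = (2 * n + 1) * (2 * card B * (e + 1))"
      by (simp only: mult_ac)
    also have "\<dots> = (2 * n + 1) * n"
      by (simp only: n_def)
    also have "\<dots> < 2 * ((n + 1) * (n + 1))"
      by (simp add: algebra_simps)
    finally show ?thesis
      by simp
  qed
  finally have "card (T (e + 2 * n * e)) < card I"
    by (simp add: I_def)
  moreover have "finite (T (e + 2 * n * e))"
    using fB by (simp add: T_def)
  moreover have "finite I"
    by (simp add: I_def)
  moreover have "D ^ (2 * n + 1) * (x ^ fst p * u ^ snd p) \<in> ?M (e + 2 * n * e)" if "p \<in> I" for p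
    using that by (intro monom_in) (auto simp: I_def)
  ultimately have "\<exists>k. (\<exists>p\<in>I. k p \<noteq> 0) \<and>
      (\<Sum>p\<in>I. hom (k p) * (D ^ (2 * n + 1) * (x ^ fst p * u ^ snd p))) = 0"
    by (intro vs.nontrivial_relation)
  then obtain k where k: "\<exists>p\<in>I. k p \<noteq> 0"
    "(\<Sum>p\<in>I. hom (k p) * (D ^ (2 * n + 1) * (x ^ fst p * u ^ snd p))) = 0"
    by blast
  have "D ^ (2 * n + 1) * (\<Sum>p\<in>I. hom (k p) * (x ^ fst p * u ^ snd p)) = 0"
    unfolding sum_distrib_left k(2)[symmetric]
    by (intro sum.cong refl) (rule mult.left_commute)
  then have "0 = (\<Sum>p\<in>I. hom (k p) * (x ^ fst p * u ^ snd p))"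
    using D0 by simp
  also have "\<dots> = (\<Sum>i\<le>n. \<Sum>j\<le>n. hom (k (i, j)) * (x ^ i * u ^ j))"
    unfolding I_def sum.cartesian_product by (intro sum.cong refl) (simp add: case_prod_beta)
  also have "\<dots> = (\<Sum>j\<le>n. (\<Sum>i\<le>n. hom (k (i, j)) * x ^ i) * u ^ j)"
    unfolding sum_distrib_right by (subst sum.swap) (simp only: mult.assoc)
  finally show ?thesis
    using k(1) by (intro exI[of _ n] exI[of _ "\<lambda>i j. k (i, j)"]) (auto simp: I_def)
qed


section \<open>Valuations and residues\<close>

locale valued_field = field_hom \<iota> for \<iota> :: "'k::field \<Rightarrow> 'K::field" +
  fixes v :: "'K \<Rightarrow> int"
  assumes val: "normalized_valuation \<iota> v"
begin

text \<open>Gives 0 infinite value in spite of the convention \<open>v 0 = 0\<close>, so that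
  closure under sums and products holds without side conditions.\<close>

definition vge :: "int \<Rightarrow> 'K \<Rightarrow> bool" where
  "vge n x \<longleftrightarrow> x = 0 \<or> n \<le> v x"

lemma v_0 [simp]: "v 0 = 0"
  and v_mult: "x \<noteq> 0 \<Longrightarrow> y \<noteq> 0 \<Longrightarrow> v (x * y) = v x + v y"
  and v_add: "x \<noteq> 0 \<Longrightarrow> y \<noteq> 0 \<Longrightarrow> x + y \<noteq> 0 \<Longrightarrow> min (v x) (v y) \<le> v (x + y)"
  and v_const: "v (\<iota> c) = 0"
  and uniformizer: "\<exists>x. x \<noteq> 0 \<and> v x = 1"
  using val by (auto simp: normalized_valuation_def) (cases "c = 0"; simp)

lemma v_1 [simp]: "v 1 = 0"
  using v_const[of 1] by simp

lemma v_uminus [simp]: "v (- x) = v x"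
proof (cases "x = 0")
  case False
  then show ?thesis
    using v_mult[of "-1" x] v_const[of "-1"] by (simp add: hom_uminus)
qed simp

lemma v_power: "x \<noteq> 0 \<Longrightarrow> v (x ^ n) = int n * v x"
  by (induction n) (auto simp: v_mult algebra_simps)

lemma v_inverse: "x \<noteq> 0 \<Longrightarrow> v (inverse x) = - v x"
  using v_mult[of x "inverse x"] by simp

lemma vge_0 [simp]: "vge n 0"
  by (simp add: vge_def)

lemma vge_add: "vge n x \<Longrightarrow> vge n y \<Longrightarrow> vge n (x + y)"
  using v_add[of x y] by (cases "x = 0"; cases "y = 0"; cases "x + y = 0") (auto simp: vge_def)

lemma vge_uminus: "vge n x \<Longrightarrow> vge n (- x)"
  by (auto simp: vge_def)

lemma vge_diff: "vge n x \<Longrightarrow> vge n y \<Longrightarrow> vge n (x - y)"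
  using vge_add[of n x "- y"] vge_uminus[of n y] by simp

lemma vge_mult: "vge m x \<Longrightarrow> vge n y \<Longrightarrow> vge (m + n) (x * y)"
  using v_mult[of x y] by (cases "x = 0"; cases "y = 0") (auto simp: vge_def)

lemma vge_mult0: "vge 0 x \<Longrightarrow> vge 0 y \<Longrightarrow> vge 0 (x * y)"
  using vge_mult[of 0 x 0 y] by simp

lemma vge_mult_left: "vge 0 x \<Longrightarrow> vge n y \<Longrightarrow> vge n (x * y)"
  using vge_mult[of 0 x n y] by simp

lemma vge_mult_right: "vge n x \<Longrightarrow> vge 0 y \<Longrightarrow> vge n (x * y)"
  using vge_mult[of n x 0 y] by simp

lemma vge_const: "vge 0 (\<iota> c)"
  by (simp add: vge_def v_const)

lemma vge_1: "vge 0 1"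
  by (simp add: vge_def)

lemma vge_numeral: "vge 0 (numeral n)"
  using vge_const[of "numeral n"] by (simp add: hom_numeral)

lemma vge_power0: "vge 0 x \<Longrightarrow> vge 0 (x ^ n)"
  by (induction n) (auto intro: vge_1 vge_mult0)

lemma vge_sum: "(\<And>i. i \<in> I \<Longrightarrow> vge n (f i)) \<Longrightarrow> vge n (sum f I)"
  by (induction I rule: infinite_finite_induct) (auto intro: vge_add)

lemma maximal_ideal_iff: "x \<in> maximal_ideal_at v \<longleftrightarrow> vge 1 x"
  by (auto simp: maximal_ideal_at_def vge_def)

lemma vge_1_const: "vge 1 (\<iota> c) \<Longrightarrow> c = 0"
  by (auto simp: vge_def v_const)

lemma residue_eqI:
  assumes "vge 1 (x - \<iota> c)"
  shows "residue_at \<iota> v x = c"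
  unfolding residue_at_def maximal_ideal_iff
proof (rule the_equality)
  fix c'
  assume "vge 1 (x - \<iota> c')"
  from vge_diff[OF assms this] have "vge 1 (\<iota> (c' - c))"
    by (simp add: hom_minus)
  then show "c' = c"
    using vge_1_const by force
qed (rule assms)

text \<open>The minimum is handled through its lower bounds, for which zero coordinates are
  harmless; a nonzero coordinate keeps \<open>Min\<close> away from the empty set.\<close>

lemma min_valuation_ge_iff:
  assumes "\<exists>x\<in>set\<^sub>v w. x \<noteq> 0"
  shows "n \<le> min_valuation v w \<longleftrightarrow> (\<forall>x\<in>set\<^sub>v w. vge n x)"
proof -
  have "finite (set\<^sub>v w)"
    by (simp add: vec_set_def)
  then show ?thesis
    using assms unfolding min_valuation_def
    by (subst Min_ge_iff) (auto simp: vge_def)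
qed

lemma min_valuation_smult:
  assumes "\<exists>x\<in>set\<^sub>v w. x \<noteq> 0" "c \<noteq> 0"
  shows "min_valuation v (c \<cdot>\<^sub>v w) = v c + min_valuation v w"
proof -
  have set: "set\<^sub>v (c \<cdot>\<^sub>v w) = (*) c ` set\<^sub>v w"
    by (auto simp: vec_set_def)
  have ex: "\<exists>x\<in>set\<^sub>v (c \<cdot>\<^sub>v w). x \<noteq> 0"
    using assms by (auto simp: set)
  have iff: "vge n (c * x) \<longleftrightarrow> vge (n - v c) x" for n x
    using assms(2) by (cases "x = 0") (auto simp: vge_def v_mult)
  have "n \<le> min_valuation v (c \<cdot>\<^sub>v w) \<longleftrightarrow> n - v c \<le> min_valuation v w" for n
    by (simp add: min_valuation_ge_iff[OF ex] min_valuation_ge_iff[OF assms(1)] set iff)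
  from this[of "min_valuation v (c \<cdot>\<^sub>v w)"] this[of "v c + min_valuation v w"]
  show ?thesis
    by simp
qed

end

section \<open>Residues at a point of the curve\<close>

locale curve_point = valued_field \<iota> v
  for \<iota> :: "'k::alg_closed_field \<Rightarrow> 'K::field" and v +
  assumes function_field: "function_field \<iota>"
begin

text \<open>
  If \<open>x\<close> had no residue in $k$, then every nonzero polynomial in \<open>x\<close> would be a unit, as $k$ is
  algebraically closed; the terms of an algebraic relation between \<open>x\<close> and a uniformizer
  would then have pairwise distinct values.
\<close>
lemma residue_exists:
  assumes "vge 0 x"
  shows "\<exists>c. vge 1 (x - \<iota> c)"
proof (rule ccontr)
  assume no: "\<not> ?thesis"
  interpret mp: map_poly_idom_hom \<iota> ..
  let ?E = "\<lambda>p. poly (map_poly \<iota> p) x"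
  have unit: "x - \<iota> c \<noteq> 0 \<and> v (x - \<iota> c) = 0" for c
  proof -
    have "\<not> vge 1 (x - \<iota> c)" "vge 0 (x - \<iota> c)"
      using no vge_diff[OF assms vge_const] by blast+
    then show ?thesis
      by (simp add: vge_def)
  qed
  have unit_poly: "?E p \<noteq> 0 \<and> v (?E p) = 0" if "p \<noteq> 0" for p
    using that
  proof (induction "degree p" arbitrary: p rule: less_induct)
    case less
    show ?case
    proof (cases "degree p = 0")
      case True
      then obtain c where "p = [:c:]"
        by (rule degree_eq_zeroE)
      then show ?thesis
        using less.prems by (simp add: v_const hom_distribs)
    next
      case False
      then obtain c where "poly p c = 0"
        using alg_closed_imp_poly_has_root by blast
      then obtain q where q: "p = [:- c, 1:] * q"
        using poly_eq_0_iff_dvd by blast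
      have "q \<noteq> 0"
        using less.prems q by auto
      then have "degree q < degree p"
        using degree_mult_eq[of "[:- c, 1:]" q] by (simp only: q) simp
      moreover have "?E p = (x - \<iota> c) * ?E q"
        unfolding q mp.hom_mult by (simp add: hom_distribs left_diff_distrib)
      ultimately show ?thesis
        using less.hyps[OF _ \<open>q \<noteq> 0\<close>] unit[of c] by (simp add: v_mult)
    qed
  qed
  obtain u where u: "u \<noteq> 0" "v u = 1"
    using uniformizer by blast
  obtain n c i0 j1 where c: "i0 \<le> n" "j1 \<le> n" "c i0 j1 \<noteq> 0"
    "(\<Sum>j\<le>n. (\<Sum>i\<le>n. \<iota> (c i j) * x ^ i) * u ^ j) = 0"
    using function_field_algebraic_relation[OF function_field, of x u] by blast
  define P where "P j = (\<Sum>i\<le>n. monom (c i j) i)" for j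
  have E_P: "?E (P j) = (\<Sum>i\<le>n. \<iota> (c i j) * x ^ i)" for j
    by (simp add: P_def mp.hom_sum poly_sum poly_monom)
  have "coeff (P j1) i0 = c i0 j1"
    using c(1) by (simp add: P_def coeff_sum)
  then have "P j1 \<noteq> 0"
    using c(3) by auto
  \<comment> \<open>A nonzero coefficient polynomial is a unit, so term \<open>j\<close> has value
    exactly \<open>j\<close>. The first nonzero term, of value \<open>j0\<close>, cannot be
    cancelled by the others, whose sum has value at least \<open>j0 + 1\<close>.\<close>
  define j0 where "j0 = (LEAST j. P j \<noteq> 0)"
  have j0: "P j0 \<noteq> 0" and "j0 \<le> j1"
    unfolding j0_def using \<open>P j1 \<noteq> 0\<close> by (rule LeastI, rule Least_le)
  then have "j0 \<le> n"
    using c(2) by simp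
  have "vge (int j0 + 1) (?E (P j) * u ^ j)" if "j \<noteq> j0" for j
  proof (cases "P j = 0")
    case False
    then have "j0 \<le> j"
      unfolding j0_def by (rule Least_le)
    then show ?thesis
      using that u unit_poly[OF False] by (simp add: vge_def v_mult v_power)
  qed simp
  then have "vge (int j0 + 1) (\<Sum>j\<in>{..n} - {j0}. ?E (P j) * u ^ j)"
    by (intro vge_sum) auto
  moreover have "?E (P j0) * u ^ j0 + (\<Sum>j\<in>{..n} - {j0}. ?E (P j) * u ^ j) = 0"
    using c(4) sum.remove[of "{..n}" j0 "\<lambda>j. ?E (P j) * u ^ j"] \<open>j0 \<le> n\<close> by (simp add: E_P)
  then have "?E (P j0) * u ^ j0 = - (\<Sum>j\<in>{..n} - {j0}. ?E (P j) * u ^ j)"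
    by (rule eq_neg_iff_add_eq_0[THEN iffD2])
  ultimately have "vge (int j0 + 1) (?E (P j0) * u ^ j0)"
    by (simp only: vge_uminus)
  then show False
    using u unit_poly[OF j0] by (simp add: vge_def v_mult v_power)
qed

abbreviation res :: "'K \<Rightarrow> 'k" where
  "res \<equiv> residue_at \<iota> v"

lemma residue_spec: "vge 0 x \<Longrightarrow> vge 1 (x - \<iota> (res x))"
  using residue_exists residue_eqI by blast

lemma res_const [simp]: "res (\<iota> c) = c"
  by (rule residue_eqI) simp

lemma res_1 [simp]: "res 1 = 1"
  and res_numeral [simp]: "res (numeral n) = numeral n"
  using res_const[of 1] res_const[of "numeral n"] by (simp_all add: hom_numeral)

lemma res_eq_0_iff: "vge 0 x \<Longrightarrow> res x = 0 \<longleftrightarrow> vge 1 x"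
  using residue_spec[of x] residue_eqI[of x 0] by auto

lemma res_add: "vge 0 x \<Longrightarrow> vge 0 y \<Longrightarrow> res (x + y) = res x + res y"
  using vge_add[OF residue_spec residue_spec, of x y]
  by (intro residue_eqI) (simp add: hom_add algebra_simps)

lemma res_diff: "vge 0 x \<Longrightarrow> vge 0 y \<Longrightarrow> res (x - y) = res x - res y"
  using vge_diff[OF residue_spec residue_spec, of x y]
  by (intro residue_eqI) (simp add: hom_minus algebra_simps)

lemma res_mult:
  assumes "vge 0 x" "vge 0 y"
  shows "res (x * y) = res x * res y"
proof (rule residue_eqI)
  have "vge 1 ((x - \<iota> (res x)) * y)" "vge 1 (\<iota> (res x) * (y - \<iota> (res y)))"
    using assms by (auto intro: vge_mult_left[OF vge_const] vge_mult_right residue_spec)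
  moreover have "x * y - \<iota> (res x * res y) = (x - \<iota> (res x)) * y + \<iota> (res x) * (y - \<iota> (res y))"
    by (simp add: hom_mult algebra_simps)
  ultimately show "vge 1 (x * y - \<iota> (res x * res y))"
    by (simp only: vge_add)
qed

lemma res_power: "vge 0 x \<Longrightarrow> res (x ^ n) = res x ^ n"
  by (induction n) (auto simp: res_mult vge_power0)

end


section \<open>Conjugation over a valued field\<close>

lemma smult_conj_model2:
  assumes "G \<in> carrier_mat 2 2" "w \<in> carrier_vec 6"
  shows "conj_model 2 G (c \<cdot>\<^sub>v w) = c \<cdot>\<^sub>v conj_model 2 G w"
proof -
  obtain \<alpha> \<beta> \<gamma> \<delta> where G: "G = mat2 \<alpha> \<beta> \<gamma> \<delta>"
    using mat2_eta[OF assms(1)] .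
  obtain a0 a1 a2 b0 b1 b2 where w: "w = model2 a0 a1 a2 b0 b1 b2"
    using model2_eta[OF assms(2)] .
  show ?thesis
    unfolding G w smult_model2 conj_model2 Let_def model2_eq_iff
    by (intro conjI; simp add: algebra_simps)
qed

text \<open>Conjugation is cubic in the matrix: two degrees from the substitution, one from the
  adjugate. Hence rescaling a matrix to determinant 1 does not move the projective point.\<close>

lemma conj_model2_scaled_mat:
  assumes "w \<in> carrier_vec 6"
  shows "conj_model 2 (mat2 (c * \<alpha>) (c * \<beta>) (c * \<gamma>) (c * \<delta>)) w =
    c ^ 3 \<cdot>\<^sub>v conj_model 2 (mat2 \<alpha> \<beta> \<gamma> \<delta>) w"
proof -
  obtain a0 a1 a2 b0 b1 b2 where w: "w = model2 a0 a1 a2 b0 b1 b2"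
    using model2_eta[OF assms] .
  show ?thesis
    unfolding w smult_model2 conj_model2 Let_def model2_eq_iff
    by (intro conjI; simp add: algebra_simps power2_eq_square power3_eq_cube)
qed

lemma conj_model2_carrier:
  assumes "G \<in> carrier_mat 2 2" "w \<in> carrier_vec 6"
  shows "conj_model 2 G w \<in> carrier_vec 6"
  by (rule mat2_eta[OF assms(1)], rule model2_eta[OF assms(2)])
    (simp add: conj_model2 Let_def)

lemma conj_model2_one:
  assumes "w \<in> carrier_vec 6"
  shows "conj_model 2 (mat2 1 0 0 1) w = w"
  by (rule model2_eta[OF assms]) (simp add: conj_model2)

lemma form_resultant_smult:
  assumes "w \<in> carrier_vec 6"
  shows "form_resultant 2 (c \<cdot>\<^sub>v w) = c ^ 4 * form_resultant 2 w"
proof -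
  obtain a0 a1 a2 b0 b1 b2 where w: "w = model2 a0 a1 a2 b0 b1 b2"
    using model2_eta[OF assms] .
  show ?thesis
    unfolding w smult_model2 form_resultant_model2
    by (simp add: power2_eq_square power4_eq_xxxx algebra_simps)
qed

lemma form_resultant_nonzero_imp:
  assumes "w \<in> carrier_vec 6" "form_resultant 2 w \<noteq> 0"
  shows "\<exists>x\<in>set\<^sub>v w. x \<noteq> 0"
proof -
  obtain a0 a1 a2 b0 b1 b2 where w: "w = model2 a0 a1 a2 b0 b1 b2"
    using model2_eta[OF assms(1)] .
  show ?thesis
    using assms(2) by (auto simp: w form_resultant_model2)
qed

context valued_field
begin

definition integral_mat :: "'K mat \<Rightarrow> bool" where
  "integral_mat G \<longleftrightarrow> G \<in> carrier_mat 2 2 \<and> (\<forall>i<2. \<forall>j<2. vge 0 (G $$ (i, j)))"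

lemma integral_mat2: "integral_mat (mat2 a b c d) \<longleftrightarrow> vge 0 a \<and> vge 0 b \<and> vge 0 c \<and> vge 0 d"
  by (auto simp: integral_mat_def less_2_cases_iff)

lemma v_divide: "x \<noteq> 0 \<Longrightarrow> y \<noteq> 0 \<Longrightarrow> v (x / y) = v x - v y"
  by (simp add: divide_inverse v_mult v_inverse)

lemma vge_divide: "y \<noteq> 0 \<Longrightarrow> vge (v y) x \<Longrightarrow> vge 0 (x / y)"
  by (cases "x = 0") (auto simp: vge_def v_divide)

text \<open>
  One step of Gaussian elimination on an entry of least value: \<open>U\<close> and \<open>V\<close> are invertible over
  the valuation ring.
\<close>
lemma smith_form:
  assumes "G \<in> GL2"
  obtains U V e f where "integral_mat U" "det U \<noteq> 0" "v (det U) = 0" "integral_mat V"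
    "e \<noteq> 0" "f \<noteq> 0" "v e \<le> v f" "v (det G) = v e + v f" "G * V = U * mat2 e 0 0 f"
proof -
  obtain a b c d where G: "G = mat2 a b c d"
    using assms mat2_eta unfolding GL2_def by blast
  have det: "a * d - b * c \<noteq> 0"
    using assms by (auto simp: GL2_def G det_mat2)
  \<comment> \<open>With pivot \<open>x\<close> the other diagonal entry is, up to sign, the
    determinant divided by \<open>x\<close>. All entries are divisible by \<open>x\<close>, so the
    determinant has value at least \<open>2 * v x\<close>, whence
    \<open>v e \<le> v f\<close>.\<close>
  have f: "(a * d - b * c) / x \<noteq> 0 \<and> v x \<le> v ((a * d - b * c) / x) \<and>
      v (a * d - b * c) = v x + v ((a * d - b * c) / x)"
    if "x \<noteq> 0" "vge (v x) a" "vge (v x) b" "vge (v x) c" "vge (v x) d" for x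
  proof -
    have "vge (v x + v x) (a * d - b * c)"
      using that by (intro vge_diff vge_mult)
    then show ?thesis
      using det that(1) by (auto simp: vge_def v_divide)
  qed
  define S where "S = {a, b, c, d} - {0}"
  have "finite S" "S \<noteq> {}"
    using det by (auto simp: S_def)
  then have "Min (v ` S) \<in> v ` S"
    by simp
  then obtain x where x: "x \<in> S" "v x = Min (v ` S)"
    by auto
  have min: "vge (v x) y" if "y \<in> {a, b, c, d}" for y
    using that \<open>finite S\<close> by (cases "y = 0") (auto simp: x(2) vge_def S_def)
  have "x \<noteq> 0"
    using x(1) by (simp add: S_def)
  note q = vge_divide[OF \<open>x \<noteq> 0\<close> min]
  note f' = f[OF \<open>x \<noteq> 0\<close> min min min min, simplified]
  have integral: "vge 0 1" "vge 0 0" "vge 0 (a / x)" "vge 0 (b / x)" "vge 0 (c / x)" "vge 0 (d / x)"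
    by (auto intro: q vge_1)
  have neg: "- ((a * d - b * c) / x) = (b * c - a * d) / x"
    by (simp add: minus_divide_left)
  \<comment> \<open>A pivot in the second column puts a swap into \<open>V\<close>, one in the
    second row puts a swap into \<open>U\<close>; a single swap changes the sign of
    \<open>f\<close>, two cancel.\<close>
  from x(1) consider "x = a" | "x = b" | "x = c" | "x = d"
    by (auto simp: S_def)
  then show ?thesis
  proof cases
    case 1
    show ?thesis
    proof (rule that)
      show "G * mat2 1 (- (b / x)) 0 1 = mat2 1 0 (c / x) 1 * mat2 x 0 0 ((a * d - b * c) / x)"
        using \<open>x \<noteq> 0\<close> unfolding G mat2_mult by (simp add: 1 field_simps)
    qed (use f' \<open>x \<noteq> 0\<close> integral in \<open>auto simp: integral_mat2 det_mat2 G intro: vge_uminus\<close>)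
  next
    case 2
    show ?thesis
    proof (rule that)
      show "G * mat2 0 1 1 (- (a / x)) = mat2 1 0 (d / x) 1 * mat2 x 0 0 (- ((a * d - b * c) / x))"
        using \<open>x \<noteq> 0\<close> unfolding neg G mat2_mult by (simp add: 2 field_simps)
    qed (use f' \<open>x \<noteq> 0\<close> integral in \<open>auto simp: integral_mat2 det_mat2 G intro: vge_uminus\<close>)
  next
    case 3
    show ?thesis
    proof (rule that)
      show "G * mat2 1 (- (d / x)) 0 1 = mat2 (a / x) 1 1 0 * mat2 x 0 0 (- ((a * d - b * c) / x))"
        using \<open>x \<noteq> 0\<close> unfolding neg G mat2_mult by (simp add: 3 field_simps)
    qed (use f' \<open>x \<noteq> 0\<close> integral in \<open>auto simp: integral_mat2 det_mat2 G intro: vge_uminus\<close>)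
  next
    case 4
    show ?thesis
    proof (rule that)
      show "G * mat2 0 1 1 (- (c / x)) = mat2 (b / x) 1 1 0 * mat2 x 0 0 ((a * d - b * c) / x)"
        using \<open>x \<noteq> 0\<close> unfolding G mat2_mult by (simp add: 4 field_simps)
    qed (use f' \<open>x \<noteq> 0\<close> integral in \<open>auto simp: integral_mat2 det_mat2 G intro: vge_uminus\<close>)
  qed
qed

text \<open>The new coordinates are linear in the old ones, with coefficients that are integer
  polynomials in the entries of \<open>G\<close>.\<close>

lemma conj_model2_integral:
  assumes "integral_mat G" "w \<in> carrier_vec 6" "\<forall>x\<in>set\<^sub>v w. vge n x"
  shows "\<forall>x\<in>set\<^sub>v (conj_model 2 G w). vge n x"
proof -
  obtain \<alpha> \<beta> \<gamma> \<delta> where G: "G = mat2 \<alpha> \<beta> \<gamma> \<delta>"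
    using mat2_eta assms(1) unfolding integral_mat_def by blast
  obtain a0 a1 a2 b0 b1 b2 where w: "w = model2 a0 a1 a2 b0 b1 b2"
    using model2_eta[OF assms(2)] .
  have g: "vge 0 \<alpha>" "vge 0 \<beta>" "vge 0 \<gamma>" "vge 0 \<delta>"
    using assms(1) by (auto simp: G integral_mat2)
  have coords: "vge n a0" "vge n a1" "vge n a2" "vge n b0" "vge n b1" "vge n b2"
    using assms(3) by (auto simp: w)
  show ?thesis
    unfolding G w conj_model2 Let_def vset_model2
    by (simp add: g coords vge_add vge_diff vge_mult_left vge_mult_right vge_power0 vge_mult0 vge_numeral)
qed

text \<open>Both the value of the resultant and the subtracted term shift by \<open>4 * v c\<close>.
  This independence of the model is what makes \<open>the_elem\<close> in
  \<open>resultant_order\<close> meaningful.\<close>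

lemma model_resultant_order_smult:
  assumes "w \<in> carrier_vec 6" "form_resultant 2 w \<noteq> 0" "c \<noteq> 0"
  shows "model_resultant_order 2 v (c \<cdot>\<^sub>v w) = model_resultant_order 2 v w"
  using assms min_valuation_smult[OF form_resultant_nonzero_imp[OF assms(1,2)] assms(3)]
  by (simp add: model_resultant_order_def form_resultant_smult v_mult v_power)

lemma resultant_order_conj_point:
  assumes "w \<in> carrier_vec 6" "form_resultant 2 w \<noteq> 0" "G \<in> GL2"
  shows "resultant_order 2 v (conj_point 2 G {c \<cdot>\<^sub>v w | c. c \<noteq> 0}) =
    v (form_resultant 2 w) + 6 * v (det G) - 4 * min_valuation v (conj_model 2 G w)"
proof -
  have G: "G \<in> carrier_mat 2 2" "det G \<noteq> 0"
    using assms(3) by (auto simp: GL2_def)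
  let ?u = "conj_model 2 G w"
  have u: "?u \<in> carrier_vec 6" "form_resultant 2 ?u \<noteq> 0"
    using G assms(1,2) by (simp_all add: conj_model2_carrier form_resultant_conj_model2)
  have "model_resultant_order 2 v (conj_model 2 G (c \<cdot>\<^sub>v w)) = model_resultant_order 2 v ?u"
    if "c \<noteq> 0" for c
    using that by (simp add: smult_conj_model2 G assms(1) model_resultant_order_smult u)
  then have "model_resultant_order 2 v ` conj_point 2 G {c \<cdot>\<^sub>v w | c. c \<noteq> 0} =
      {model_resultant_order 2 v ?u}"
    by (force simp: conj_point_def image_iff intro: exI[of _ 1])
  then show ?thesis
    using G assms(1,2)
    by (simp add: resultant_order_def model_resultant_order_def form_resultant_conj_model2 v_mult v_power)
qed

lemma normalized_model:
  assumes "w \<in> carrier_vec 6" "\<exists>x\<in>set\<^sub>v w. x \<noteq> 0"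
  obtains c where "c \<noteq> 0" "min_valuation v (c \<cdot>\<^sub>v w) = 0"
proof -
  obtain u where u: "u \<noteq> 0" "v u = 1"
    using uniformizer by blast
  let ?m = "min_valuation v w"
  \<comment> \<open>The power of the uniformizer with integer exponent \<open>- ?m\<close>.\<close>
  let ?c = "if ?m \<le> 0 then u ^ nat (- ?m) else inverse (u ^ nat ?m)"
  have "?c \<noteq> 0" "v ?c = - ?m"
    using u by (auto simp: v_power v_inverse)
  then show ?thesis
    using min_valuation_smult[OF assms(2) \<open>?c \<noteq> 0\<close>] by (intro that[of ?c]) auto
qed

end

section \<open>Reduction of conjugated models and semi-stability\<close>

context curve_point
begin

text \<open>The coordinates of the conjugate are integer polynomials in integral elements, and
  \<open>res\<close> is a ring homomorphism on the valuation ring.\<close>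

lemma res_conj_model2:
  assumes "integral_mat (mat2 \<alpha> \<beta> \<gamma> \<delta>)" "w \<in> carrier_vec 6" "\<forall>x\<in>set\<^sub>v w. vge 0 x"
  shows "map_vec res (conj_model 2 (mat2 \<alpha> \<beta> \<gamma> \<delta>) w) =
    conj_model 2 (mat2 (res \<alpha>) (res \<beta>) (res \<gamma>) (res \<delta>)) (map_vec res w)"
proof -
  obtain a0 a1 a2 b0 b1 b2 where w: "w = model2 a0 a1 a2 b0 b1 b2"
    using model2_eta[OF assms(2)] .
  have g: "vge 0 \<alpha>" "vge 0 \<beta>" "vge 0 \<gamma>" "vge 0 \<delta>"
    using assms(1) by (auto simp: integral_mat2)
  have coords: "vge 0 a0" "vge 0 a1" "vge 0 a2" "vge 0 b0" "vge 0 b1" "vge 0 b2"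
    using assms(3) by (auto simp: w)
  show ?thesis
    unfolding w conj_model2 Let_def map_model2
    by (simp add: g coords vge_add vge_diff vge_mult0 vge_power0 vge_numeral
        res_add res_diff res_mult res_power)
qed

lemma unstable_reduction:
  assumes "w \<in> carrier_vec 6" "\<exists>x\<in>set\<^sub>v w. x \<noteq> 0" "min_valuation v w = 0"
    and U: "integral_mat U" "det U \<noteq> 0" "v (det U) = 0"
    and wU: "conj_model 2 U w = model2 a0 a1 a2 b0 b1 b2"
    and small: "vge 1 a0" "vge 1 b0" "vge 1 b1"
  shows "unstable 2 (reduction \<iota> v {c \<cdot>\<^sub>v w | c. c \<noteq> 0})"
proof -
  obtain \<alpha> \<beta> \<gamma> \<delta> where U': "U = mat2 \<alpha> \<beta> \<gamma> \<delta>"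
    using mat2_eta U(1) unfolding integral_mat_def by blast
  have g: "vge 0 \<alpha>" "vge 0 \<beta>" "vge 0 \<gamma>" "vge 0 \<delta>"
    using U(1) by (auto simp: U' integral_mat2)
  have int: "\<forall>x\<in>set\<^sub>v w. vge 0 x"
    using min_valuation_ge_iff[OF assms(2), of 0] assms(3) by simp
  let ?u = "map_vec res w" and ?V = "mat2 (res \<alpha>) (res \<beta>) (res \<gamma>) (res \<delta>)"
  have u: "?u \<in> carrier_vec 6"
    using assms(1) by simp
  have "det ?V = res (det U)"
    by (simp add: U' det_mat2 g vge_mult0 res_diff res_mult)
  moreover have "res (det U) \<noteq> 0"
    using U(2,3) res_eq_0_iff[of "det U"] by (simp add: vge_def)
  ultimately have detV: "res \<alpha> * res \<delta> - res \<beta> * res \<gamma> \<noteq> 0"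
    by (simp add: det_mat2)
  \<comment> \<open>The determinant is quadratic in the matrix, so normalizing it takes a square
    root, available because k is algebraically closed.\<close>
  obtain \<sigma> where \<sigma>: "\<sigma> ^ 2 = res \<alpha> * res \<delta> - res \<beta> * res \<gamma>"
    using nth_root_exists[of 2 "res \<alpha> * res \<delta> - res \<beta> * res \<gamma>"] by auto
  have \<sigma>0: "\<sigma> \<noteq> 0"
    using \<sigma> detV by auto
  define \<tau> where "\<tau> = inverse \<sigma>"
  define H where "H = mat2 (\<tau> * res \<alpha>) (\<tau> * res \<beta>) (\<tau> * res \<gamma>) (\<tau> * res \<delta>)"
  have "det H = \<tau> ^ 2 * (res \<alpha> * res \<delta> - res \<beta> * res \<gamma>)"
    by (simp add: H_def det_mat2 power2_eq_square algebra_simps)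
  also have "\<dots> = 1"
    using \<sigma>0 by (simp flip: \<sigma>) (simp add: \<tau>_def power_inverse)
  finally have "H \<in> SL2"
    by (simp add: SL2_def H_def)
  have "coeffs_a 2 y $ 0 = 0 \<and> coeffs_b 2 y $ 0 = 0 \<and> coeffs_b 2 y $ 1 = 0"
    if y: "y \<in> conj_point 2 H (reduction \<iota> v {c \<cdot>\<^sub>v w | c. c \<noteq> 0})" for y :: "'k vec"
  proof -
    obtain c where c: "c \<noteq> 0" "min_valuation v (c \<cdot>\<^sub>v w) = 0"
        "y = conj_model 2 H (map_vec res (c \<cdot>\<^sub>v w))"
      using y by (auto simp: conj_point_def reduction_def)
    \<comment> \<open>Two normalized models differ by a unit \<open>c\<close>, and its residue comes
      out as a scalar. The vanishing of coordinates is therefore the same for all representatives of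
      the reduction.\<close>
    have "v c = 0"
      using c(2) min_valuation_smult[OF assms(2) c(1)] assms(3) by simp
    then have "map_vec res (c \<cdot>\<^sub>v w) = res c \<cdot>\<^sub>v ?u"
      using int by (intro eq_vecI) (auto simp: vge_def res_mult vec_set_def)
    then have "y = (res c * \<tau> ^ 3) \<cdot>\<^sub>v conj_model 2 ?V ?u"
      by (simp only: c(3) H_def smult_conj_model2[OF mat2_carrier u] conj_model2_scaled_mat[OF u]
          smult_smult_assoc)
    also have "conj_model 2 ?V ?u = map_vec res (conj_model 2 U w)"
      using res_conj_model2[of \<alpha> \<beta> \<gamma> \<delta> w] U(1) assms(1) int by (simp add: U')
    also have "\<dots> = model2 0 (res a1) (res a2) 0 0 (res b2)"
      using small residue_eqI[of _ 0] by (simp add: wU map_model2)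
    finally show ?thesis
      by (simp add: smult_model2)
  qed
  \<comment> \<open>For d = 2 the bounds are 1/2 and 3/2, leaving i = 0 and j = 0, 1.\<close>
  then have "(\<forall>i\<le>2. real i \<le> (real 2 - 1) / 2 \<longrightarrow> coeffs_a 2 y $ i = 0) \<and>
      (\<forall>j\<le>2. real j \<le> (real 2 + 1) / 2 \<longrightarrow> coeffs_b 2 y $ j = 0)"
    if "y \<in> conj_point 2 H (reduction \<iota> v {c \<cdot>\<^sub>v w | c. c \<noteq> 0})" for y :: "'k vec"
    using that by (auto simp: le_Suc_eq numeral_2_eq_2)
  then show ?thesis
    unfolding unstable_def using \<open>H \<in> SL2\<close> by blast
qed

lemma semi_stable_bound:
  assumes w: "w \<in> carrier_vec 6" "form_resultant 2 w \<noteq> 0" "min_valuation v w = 0"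
    and ss: "semi_stable 2 (reduction \<iota> v {c \<cdot>\<^sub>v w | c. c \<noteq> 0})"
    and G: "G \<in> GL2"
  shows "2 * min_valuation v (conj_model 2 G w) \<le> 3 * v (det G)"
proof (rule ccontr)
  let ?s = "min_valuation v (conj_model 2 G w)"
  assume "\<not> ?thesis"
  then have s: "3 * v (det G) < 2 * ?s"
    by simp
  have G': "G \<in> carrier_mat 2 2" "det G \<noteq> 0"
    using G by (auto simp: GL2_def)
  have wG: "conj_model 2 G w \<in> carrier_vec 6" "form_resultant 2 (conj_model 2 G w) \<noteq> 0"
    using G' w(1,2) by (simp_all add: conj_model2_carrier form_resultant_conj_model2)
  obtain U V e f where U: "integral_mat U" "det U \<noteq> 0" "v (det U) = 0" and V: "integral_mat V"
    and ef: "e \<noteq> 0" "f \<noteq> 0" "v e \<le> v f" "v (det G) = v e + v f" and GV: "G * V = U * mat2 e 0 0 f"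
    using smith_form[OF G] .
  have UV: "U \<in> carrier_mat 2 2" "V \<in> carrier_mat 2 2"
    using U V by (auto simp: integral_mat_def)
  have "\<forall>x\<in>set\<^sub>v (conj_model 2 G w). vge ?s x"
    using min_valuation_ge_iff[OF form_resultant_nonzero_imp[OF wG], of ?s] by simp
  then have "\<forall>x\<in>set\<^sub>v (conj_model 2 V (conj_model 2 G w)). vge ?s x"
    by (rule conj_model2_integral[OF V wG(1)])
  also have "conj_model 2 V (conj_model 2 G w) = conj_model 2 (mat2 e 0 0 f) (conj_model 2 U w)"
    using UV G' w(1) by (simp add: conj_model2_comp GV)
  finally have ge: "\<forall>x\<in>set\<^sub>v (conj_model 2 (mat2 e 0 0 f) (conj_model 2 U w)). vge ?s x" .
  obtain a0 a1 a2 b0 b1 b2 where wU: "conj_model 2 U w = model2 a0 a1 a2 b0 b1 b2"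
    using model2_eta[OF conj_model2_carrier[OF UV(1) w(1)]] .
  have "vge ?s (f * (a0 * e^2))" "vge ?s (e * (b0 * e^2))" "vge ?s (e * (b1 * (e * f)))"
    using ge by (auto simp: wU conj_model2)
  \<comment> \<open>A nonzero one of these coordinates has value at least \<open>?s\<close> minus
    that of \<open>e^2 * f\<close> or \<open>e^3\<close>, which is at most 3/2 v(det G). The
    difference is positive, and values are integers.\<close>
  then have "vge 1 a0 \<and> vge 1 b0 \<and> vge 1 b1"
    using ef s by (cases "a0 = 0"; cases "b0 = 0"; cases "b1 = 0") (auto simp: vge_def v_mult v_power)
  then have "vge 1 a0" "vge 1 b0" "vge 1 b1"
    by blast+
  then have "unstable 2 (reduction \<iota> v {c \<cdot>\<^sub>v w | c. c \<noteq> 0})"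
    by (rule unstable_reduction[OF w(1) form_resultant_nonzero_imp[OF w(1,2)] w(3) U wU])
  then show False
    using ss by (simp add: semi_stable_def)
qed

end

theorem theorem5p7:
  fixes \<iota> :: "'k::{alg_closed_field, field_char_0} \<Rightarrow> 'K::field"
    and C :: "('K \<Rightarrow> int) set"
    and p :: "'K \<Rightarrow> int"
    and \<phi> :: "'K alg_closure vec set \<Rightarrow> 'K alg_closure vec set"
    and \<Phi> :: "'K vec set"
  assumes "nonsingular_curve \<iota> C"
    and "morphism_of_degree 2 \<phi>"
    and "is_presentation 2 \<phi> \<Phi>"
    and "p \<in> C"
    and "semi_stable 2 (reduction \<iota> p \<Phi>)"
  shows "minimal_resultant C 2 \<phi> p = resultant_divisor C 2 \<Phi> p"
proof -
  have ff: "function_field \<iota>" and val: "normalized_valuation \<iota> p"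
    using assms(1,4) by (auto simp: nonsingular_curve_def)
  interpret field_hom \<iota>
    using ff by (simp add: function_field_def)
  interpret curve_point \<iota> p
    by unfold_locales (rule val, rule ff)
  have "inj \<iota>"
  proof (rule injI)
    fix x y
    assume "\<iota> x = \<iota> y"
    then have "vge 1 (\<iota> (x - y))"
      by (simp add: hom_minus)
    then show "x = y"
      using vge_1_const by force
  qed
  \<comment> \<open>Characteristic 0 makes k infinite, hence also K; polynomial identities over K
    may then be checked on values.\<close>
  then have inf: "infinite (UNIV :: 'K set)"
    using infinite_UNIV_char_0[where ?'a = 'k] finite_imageD[of \<iota> UNIV] finite_subset[OF subset_UNIV]
    by blast
  obtain w0 where w0: "w0 \<in> carrier_vec 6" "\<Phi> = {c \<cdot>\<^sub>v w0 | c. c \<noteq> 0}"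
    using assms(3) by (auto simp: is_presentation_def elim: proj_space_cases)
  have "w0 \<in> \<Phi>"
    by (auto simp: w0(2) intro!: exI[of _ 1])
  then have "form_resultant 2 w0 \<noteq> 0"
    using no_common_zero_imp_form_resultant[OF w0(1)] assms(3) by (simp add: is_presentation_def)
  from normalized_model[OF w0(1) form_resultant_nonzero_imp[OF w0(1) this]]
  obtain c0 where c0: "c0 \<noteq> 0" "min_valuation p (c0 \<cdot>\<^sub>v w0) = 0" .
  \<comment> \<open>For a normalized model the order of \<open>\<Phi>\<close> is just the value of
    the resultant.\<close>
  define w where "w = c0 \<cdot>\<^sub>v w0"
  have w: "w \<in> carrier_vec 6" "min_valuation p w = 0"
    using w0(1) c0(2) by (simp_all add: w_def)
  have \<rho>: "form_resultant 2 w \<noteq> 0"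
    using \<open>form_resultant 2 w0 \<noteq> 0\<close> c0(1) by (simp add: w_def form_resultant_smult w0(1))
  have \<Phi>: "\<Phi> = {c \<cdot>\<^sub>v w | c. c \<noteq> 0}"
  proof -
    have "c \<cdot>\<^sub>v w0 = (c / c0) \<cdot>\<^sub>v w" for c
      using c0(1) by (simp add: w_def smult_smult_assoc)
    then have "\<Phi> \<subseteq> {c \<cdot>\<^sub>v w | c. c \<noteq> 0}"
      using c0(1) unfolding w0(2) by (smt (verit) Collect_mono divide_eq_0_iff)
    moreover have "{c \<cdot>\<^sub>v w | c. c \<noteq> 0} \<subseteq> \<Phi>"
      using c0(1) by (auto simp: w0(2) w_def smult_smult_assoc)
    ultimately show ?thesis
      by blast
  qed
  have ord: "resultant_order 2 p (conj_point 2 G \<Phi>) =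
      p (form_resultant 2 w) + 6 * p (det G) - 4 * min_valuation p (conj_model 2 G w)"
    if "G \<in> GL2" for G
    unfolding \<Phi> by (rule resultant_order_conj_point[OF w(1) \<rho> that])
  have one: "mat2 1 0 0 1 \<in> (GL2 :: 'K mat set)"
    by (simp add: GL2_def det_mat2)
  have "conj_point 2 (mat2 1 0 0 1) \<Phi> = \<Phi>"
    using w(1) by (force simp: \<Phi> conj_point_def conj_model2_one)
  then have ord_one: "resultant_order 2 p \<Phi> = p (form_resultant 2 w)"
    using ord[OF one] by (simp add: det_mat2 conj_model2_one w)
  have "(LEAST n. \<exists>\<Phi>' G. is_presentation 2 \<phi> \<Phi>' \<and> G \<in> GL2 \<and>
      n = resultant_order 2 p (conj_point 2 G \<Phi>')) = resultant_order 2 p \<Phi>"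
  \<comment> \<open>On the integers \<open>LEAST\<close> requires an attained lower bound; the
    identity matrix attains it.\<close>
  proof (rule Least_equality)
    show "\<exists>\<Phi>' G. is_presentation 2 \<phi> \<Phi>' \<and> G \<in> GL2 \<and>
        resultant_order 2 p \<Phi> = resultant_order 2 p (conj_point 2 G \<Phi>')"
      using assms(3) one \<open>conj_point 2 (mat2 1 0 0 1) \<Phi> = \<Phi>\<close>
      by (intro exI[of _ \<Phi>] exI[of _ "mat2 1 0 0 1"]) simp
  next
    fix n
    assume "\<exists>\<Phi>' G. is_presentation 2 \<phi> \<Phi>' \<and> G \<in> GL2 \<and>
      n = resultant_order 2 p (conj_point 2 G \<Phi>')"
    then obtain G where G: "G \<in> GL2" "n = resultant_order 2 p (conj_point 2 G \<Phi>)"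
      using presentation_unique[OF inf assms(3)] by blast
    \<comment> \<open>Doubled, this says that the change \<open>6 * p (det G) - 4 * n\<close> of the
      order, with n the minimal value of the conjugated model, is nonnegative.\<close>
    have "2 * min_valuation p (conj_model 2 G w) \<le> 3 * p (det G)"
      using semi_stable_bound[OF w(1) \<rho> w(2) _ G(1)] assms(5) by (simp add: \<Phi>)
    then show "resultant_order 2 p \<Phi> \<le> n"
      using ord[OF G(1)] by (simp add: G(2) ord_one)
  qed
  then show ?thesis
    using assms(4) by (simp add: minimal_resultant_def resultant_divisor_def)
qed

end
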